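(* Let $n\ge 1$, let $\sigma\in\mathfrak{S}_n$ be a $132$-avoiding permutation, and let $\mu=\alpha(\sigma)$ be the corresponding Dyck path of length $2n$. Then $$\sum_{D\in \mathcal{D}( */\mu)} q^{\mathrm{tiles}(D)} = \sum_{\pi\ge\sigma} q^{\mathrm{inv}(\pi)-\mathrm{inv}(\sigma)},$$ where the sum on the right is over all $\pi\in\mathfrak{S}_n$ with $\pi\ge\sigma$ in the Bruhat order on $\mathfrak{S}_n$.
   Context: Dyck tilings. A Dyck path of length $2n$ is a lattice path of up steps $(0,1)$ and down steps $(1,0)$ from $(0,0)$ to $(n,n)$ never going strictly below the line $y=x$. Cells are unit squares with integer corners. A Dyck tile is a ribbon (finite set of cells) such that the centers of its cells are the lattice points of a translate of a Dyck path (a Dyck path of length $0$ is allowed, giving a single cell). For Dyck paths $\lambda,\mu$ of length $2n$ with $\mu$ weakly above $\lambda$, a Dyck tiling of $\lambda/\mu$ is a tiling $D$ by Dyck tiles of the region between $\lambda$ and $\mu$ that is cover-inclusive: if $\eta$ is a tile of $D$, then the translate of $\eta$ by $(1,-1)$ is either completely below $\lambda$ or contained in another tile of $D$. Here $\lambda$ is the lower path and $\mu$ the upper path. $\mathcal{D}( */\mu)$ is the set of all Dyck tilings with fixed upper path $\mu$ (and arbitrary lower path), and $\mathrm{tiles}(D)$ is the number of tiles of $D$. Permutations. $\mathfrak{S}_n$ is the set of permutations of $[n]=\{1,\dots,n\}$; $\mathrm{inv}(\pi)$ is the number of pairs $i<j$ with $\pi(i)>\pi(j)$. $\sigma$ is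 $132$-avoiding if there are no $i<j<k$ with $\sigma(i)<\sigma(k)<\sigma(j)$. The map $\alpha$. Represent $\sigma$ in an $n\times n$ grid of cells with a dot in the cell in the $i$th row from the top and $j$th column from the left whenever $\sigma(j)=i$. Put a cross in each cell having a dot to its right in the same row and a dot below it in the same column (crosses correspond to inversions). If $\sigma$ is $132$-avoiding, the crosses form a top-left justified Ferrers diagram, and $\alpha(\sigma)$ is the lattice path from the bottom-left corner $(0,0)$ to the top-right corner $(n,n)$ of the grid following the boundary of this diagram (crossed cells lie above the path). It is a Dyck path, and $\alpha$ is a bijection from $132$-avoiding permutations in $\mathfrak{S}_n$ to Dyck paths of length $2n$. *)

theory Defs
  imports
    "HOL-Library.Disjoint_Sets"
    "HOL-Combinatorics.Permutations"
    "HOL-Computational_Algebra.Polynomial"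
begin

section \<open>Lattice paths and Dyck paths\<close>

text \<open>\<open>Up\<close> is the step \<open>(0,1)\<close> and \<open>Down\<close> is the step \<open>(1,0)\<close>. All paths start at \<open>(0,0)\<close>.\<close>

datatype step = Up | Down

definition vertex :: "step list \<Rightarrow> nat \<Rightarrow> int \<times> int" where
  "vertex p k = (int (count_list (take k p) Down), int (count_list (take k p) Up))"

definition vertices :: "step list \<Rightarrow> (int \<times> int) set" where
  "vertices p = vertex p ` {0..length p}"

definition lattice_path :: "nat \<Rightarrow> step list \<Rightarrow> bool" where
  "lattice_path n p \<longleftrightarrow> vertex p (length p) = (int n, int n)"

definition dyck_path :: "nat \<Rightarrow> step list \<Rightarrow> bool" where
  "dyck_path n p \<longleftrightarrow> lattice_path n p \<and> (\<forall>(x, y) \<in> vertices p. x \<le> y)"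

text \<open>The \<open>k\<close>-th vertices of two paths lie on the common antidiagonal \<open>x + y = k\<close>, so that
  their relative position is given by their second coordinates.\<close>

definition weakly_above :: "nat \<Rightarrow> step list \<Rightarrow> step list \<Rightarrow> bool" where
  "weakly_above n \<mu> lam \<longleftrightarrow> (\<forall>k \<le> 2 * n. snd (vertex lam k) \<le> snd (vertex \<mu> k))"


section \<open>Cells\<close>

text \<open>The pair \<open>(a, b)\<close> stands for the cell \<open>[a, a+1] \<times> [b, b+1]\<close>, that is, a cell is
  identified with its lower left corner. Its center is \<open>(a, b) + (1/2, 1/2)\<close>.\<close>

type_synonym cell = "int \<times> int"

text \<open>\<open>p\<close> contains the unit step from \<open>(a, h)\<close> to \<open>(a + 1, h)\<close>.\<close>

definition down_step_at :: "step list \<Rightarrow> int \<Rightarrow> int \<Rightarrow> bool" where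
  "down_step_at p a h \<longleftrightarrow> (\<exists>k < length p. p ! k = Down \<and> vertex p k = (a, h))"

definition cell_above :: "step list \<Rightarrow> cell \<Rightarrow> bool" where
  "cell_above p = (\<lambda>(a, b). \<exists>h. down_step_at p a h \<and> h \<le> b)"

definition cell_below :: "step list \<Rightarrow> cell \<Rightarrow> bool" where
  "cell_below p = (\<lambda>(a, b). \<exists>h. down_step_at p a h \<and> b + 1 \<le> h)"

definition region :: "step list \<Rightarrow> step list \<Rightarrow> cell set" where
  "region lam \<mu> = {c. cell_above lam c \<and> cell_below \<mu> c}"

definition translate :: "int \<times> int \<Rightarrow> (int \<times> int) set \<Rightarrow> (int \<times> int) set" where
  "translate v S = (\<lambda>(x, y). (x + fst v, y + snd v)) ` S"


section \<open>Dyck tilings\<close>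

text \<open>Since centers differ from lower left corners by a constant vector, the centers of the
  cells of \<open>T\<close> form a translate of a Dyck path iff the lower left corners do.\<close>

definition dyck_tile :: "cell set \<Rightarrow> bool" where
  "dyck_tile T \<longleftrightarrow> (\<exists>k p v. dyck_path k p \<and> T = translate v (vertices p))"

definition cover_inclusive :: "step list \<Rightarrow> cell set set \<Rightarrow> bool" where
  "cover_inclusive lam D \<longleftrightarrow>
    (\<forall>\<eta> \<in> D. (\<forall>c \<in> translate (1, -1) \<eta>. cell_below lam c) \<or>
              (\<exists>\<eta>' \<in> D. \<eta>' \<noteq> \<eta> \<and> translate (1, -1) \<eta> \<subseteq> \<eta>'))"

definition dyck_tiling :: "nat \<Rightarrow> step list \<Rightarrow> step list \<Rightarrow> cell set set \<Rightarrow> bool" where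
  "dyck_tiling n lam \<mu> D \<longleftrightarrow>
    dyck_path n lam \<and> dyck_path n \<mu> \<and> weakly_above n \<mu> lam \<and>
    partition_on (region lam \<mu>) D \<and> (\<forall>\<eta> \<in> D. dyck_tile \<eta>) \<and> cover_inclusive lam D"

text \<open>The set of Dyck tilings with upper path \<open>\<mu>\<close> and arbitrary lower path. The lower path need
  not be recorded: it is determined by \<open>\<mu>\<close> and the region \<open>\<Union>D\<close> covered by the tiling.\<close>

definition dyck_tilings_upper :: "nat \<Rightarrow> step list \<Rightarrow> cell set set set" where
  "dyck_tilings_upper n \<mu> = {D. \<exists>lam. dyck_tiling n lam \<mu> D}"

definition tiles :: "cell set set \<Rightarrow> nat" where
  "tiles D = card D"


section \<open>Permutations and Bruhat order\<close>

definition inversions :: "nat \<Rightarrow> (nat \<Rightarrow> nat) \<Rightarrow> nat" where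
  "inversions n \<pi> = card {(i, j). i \<in> {1..n} \<and> j \<in> {1..n} \<and> i < j \<and> \<pi> i > \<pi> j}"

definition avoids_132 :: "nat \<Rightarrow> (nat \<Rightarrow> nat) \<Rightarrow> bool" where
  "avoids_132 n \<sigma> \<longleftrightarrow>
    \<not> (\<exists>i \<in> {1..n}. \<exists>j \<in> {1..n}. \<exists>k \<in> {1..n}. i < j \<and> j < k \<and> \<sigma> i < \<sigma> k \<and> \<sigma> k < \<sigma> j)"

text \<open>Bruhat order is the reflexive transitive closure of \<open>u \<rightarrow> u t\<close>, for \<open>t\<close> a transposition
  with \<open>u t\<close> of larger length (number of inversions) than \<open>u\<close>.\<close>

definition bruhat_step :: "nat \<Rightarrow> (nat \<Rightarrow> nat) \<Rightarrow> (nat \<Rightarrow> nat) \<Rightarrow> bool" where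
  "bruhat_step n u v \<longleftrightarrow>
    (\<exists>a \<in> {1..n}. \<exists>b \<in> {1..n}. v = u \<circ> transpose a b \<and> inversions n u < inversions n v)"

definition bruhat_le :: "nat \<Rightarrow> (nat \<Rightarrow> nat) \<Rightarrow> (nat \<Rightarrow> nat) \<Rightarrow> bool" where
  "bruhat_le n = (bruhat_step n)\<^sup>*\<^sup>*"


section \<open>The map from 132-avoiding permutations to Dyck paths\<close>

text \<open>Grid positions are written \<open>(i, j)\<close>, with \<open>i\<close> the row counted from the top and \<open>j\<close> the
  column counted from the left, both starting at \<open>1\<close>.\<close>

definition dots :: "nat \<Rightarrow> (nat \<Rightarrow> nat) \<Rightarrow> (nat \<times> nat) set" where
  "dots n \<sigma> = {(i, j). i \<in> {1..n} \<and> j \<in> {1..n} \<and> \<sigma> j = i}"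

definition crosses :: "nat \<Rightarrow> (nat \<Rightarrow> nat) \<Rightarrow> (nat \<times> nat) set" where
  "crosses n \<sigma> =
    {(i, j). (\<exists>j' > j. (i, j') \<in> dots n \<sigma>) \<and> (\<exists>i' > i. (i', j) \<in> dots n \<sigma>)} \<inter> {1..n} \<times> {1..n}"

definition grid_cell :: "nat \<Rightarrow> nat \<times> nat \<Rightarrow> cell" where
  "grid_cell n = (\<lambda>(i, j). (int j - 1, int n - int i))"

text \<open>The path from the bottom left to the top right corner of the grid along the boundary of the
  diagram of crosses, i.e. such that the crossed cells are exactly the cells of the grid above
  it. For 132-avoiding \<open>\<sigma>\<close> the crosses form a top-left justified Ferrers diagram, so that
  this path exists and is unique.\<close>

definition alpha :: "nat \<Rightarrow> (nat \<Rightarrow> nat) \<Rightarrow> step list" where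
  "alpha n \<sigma> = (THE p. lattice_path n p \<and>
     {c \<in> grid_cell n ` ({1..n} \<times> {1..n}). cell_above p c} = grid_cell n ` crosses n \<sigma>)"

end

theory Submission
  imports Defs
begin

text \<open>
  Both sides are equal to a product of \<open>q\<close>-integers, one for each column of the grid: if \<open>c\<^sub>j\<close> is
  the number of crosses in column \<open>j\<close>, then the down step of \<open>\<mu>\<close> in that column starts at height
  \<open>n - c\<^sub>j\<close>, that is, \<open>n - c\<^sub>j - j + 1\<close> above the diagonal, and both sums are
  \<open>\<Prod>\<^sub>j [n - c\<^sub>j - j + 1]\<^sub>q\<close>.

  For permutations, the number \<open>c\<^sub>j\<close> is the \<open>j\<close>-th entry of the Lehmer code of \<open>\<sigma>\<close>. A step upwards in
  Bruhat order replaces two dots by the other two corners of the rectangle that they span. These lie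
  below or to the right of its upper left corner, so a dot never enters the top-left justified
  diagram of crosses of \<open>\<sigma>\<close>. Conversely, if the dots of \<open>\<pi>\<close>
  avoid this diagram and \<open>\<pi> \<noteq> \<sigma>\<close>, then \<open>\<pi>\<close> has a cross outside the diagram, and undoing the inversion
  belonging to it goes down in Bruhat order without entering the diagram. Therefore \<open>\<pi> \<ge> \<sigma>\<close> holds
  exactly if the dots of \<open>\<pi>\<close> avoid the crosses of \<open>\<sigma>\<close>, and this in turn holds exactly if the Lehmer
  code of \<open>\<pi>\<close> dominates that of \<open>\<sigma>\<close> in each entry (\<open>bruhat_le_iff_lehmer_le\<close>). Codes
  can be chosen entry by entry and their sum is the number of inversions, so the sum factors
  (\<open>sum_bruhat_ge\<close>).

  For tilings, consider a peak of the upper path, \<open>\<mu> = \<alpha> Up Down \<beta>\<close>. Tilings in which the cell under the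
  peak is a tile by itself correspond, by removal of this tile, to the tilings with upper path
  \<open>\<alpha> Down Up \<beta>\<close> (\<open>tilings_with_peak_tile\<close>). In every other tiling, cover-inclusivity forces each
  tile that meets the antidiagonal of the peak, or one of the two next to it, to pass through a peak
  of its own there, and the lower path to have a peak there as well; cutting out all these peaks
  yields each tiling with upper path \<open>\<alpha> \<beta>\<close> exactly once (\<open>tilings_without_peak_tile\<close>). Writing
  \<open>F\<close> for the generating function of the tilings,
  \<open>F (\<alpha> Up Down \<beta>) = q F (\<alpha> Down Up \<beta>) + F (\<alpha> \<beta>)\<close>, where the first term on the right vanishes if its path falls
  below the diagonal. The product over the down steps of the \<open>q\<close>-integers of their
  starting heights satisfies the same recursion because \<open>[h + 1]\<^sub>q = q [h]\<^sub>q + 1\<close>, and applying the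
  recursion to the first peak of \<open>\<mu>\<close> gives the product formula by induction
  (\<open>dyck_tilings_sum_eq_height_weight\<close>).
\<close>

section \<open>Lehmer codes\<close>

definition lehmer :: "nat \<Rightarrow> (nat \<Rightarrow> nat) \<Rightarrow> nat \<Rightarrow> nat" where
  "lehmer n \<pi> j = card {k \<in> {j<..n}. \<pi> k < \<pi> j}"

lemma inversions_eq_sum_lehmer: "inversions n \<pi> = (\<Sum>j\<in>{1..n}. lehmer n \<pi> j)"
proof -
  have "{(i, j). i \<in> {1..n} \<and> j \<in> {1..n} \<and> i < j \<and> \<pi> i > \<pi> j}
      = (SIGMA j:{1..n}. {k \<in> {j<..n}. \<pi> k < \<pi> j})"
    by auto
  then show ?thesis
    by (simp add: inversions_def lehmer_def)
qed

lemma lehmer_le: "lehmer n \<pi> j \<le> n - j"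
proof -
  have "lehmer n \<pi> j \<le> card {j<..n}"
    unfolding lehmer_def by (intro card_mono) auto
  then show ?thesis by simp
qed

lemma lehmer_eq_card_unused_values:
  assumes "\<pi> permutes {1..n}" "j \<in> {1..n}"
  shows "lehmer n \<pi> j = card {v \<in> {1..n} - \<pi> ` {1..<j}. v < \<pi> j}"
proof -
  have inj: "inj \<pi>" using assms(1) by (rule permutes_inj)
  have "{v \<in> {1..n} - \<pi> ` {1..<j}. v < \<pi> j} = \<pi> ` {k \<in> {j<..n}. \<pi> k < \<pi> j}"
  proof (intro equalityI subsetI)
    fix v assume v: "v \<in> {v \<in> {1..n} - \<pi> ` {1..<j}. v < \<pi> j}"
    then have "v \<in> \<pi> ` {1..n}" using permutes_image[OF assms(1)] by simp
    then obtain k where "k \<in> {1..n}" "v = \<pi> k" by blast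
    moreover have "k \<noteq> j" using v \<open>v = \<pi> k\<close> by blast
    moreover have "\<not> k < j"
    proof
      assume "k < j"
      then have "k \<in> {1..<j}" using \<open>k \<in> {1..n}\<close> by simp
      then show False using v \<open>v = \<pi> k\<close> by blast
    qed
    ultimately show "v \<in> \<pi> ` {k \<in> {j<..n}. \<pi> k < \<pi> j}" using v by auto
  next
    fix v assume "v \<in> \<pi> ` {k \<in> {j<..n}. \<pi> k < \<pi> j}"
    then obtain k where k: "v = \<pi> k" "j < k" "k \<le> n" "\<pi> k < \<pi> j" by auto
    then have "\<pi> k \<in> {1..n}" using permutes_in_image[OF assms(1), of k] by auto
    moreover have "\<pi> k \<notin> \<pi> ` {1..<j}" using k by (simp add: inj_image_mem_iff[OF inj])
    ultimately show "v \<in> {v \<in> {1..n} - \<pi> ` {1..<j}. v < \<pi> j}" using k by auto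
  qed
  moreover have "card (\<pi> ` {k \<in> {j<..n}. \<pi> k < \<pi> j}) = card {k \<in> {j<..n}. \<pi> k < \<pi> j}"
    by (rule card_image[OF inj_on_subset[OF inj subset_UNIV]])
  ultimately show ?thesis by (simp only: lehmer_def)
qed

text \<open>
  A permutation is recovered from its code from left to right: once the values at earlier
  positions are known, the entry \<open>lehmer n \<pi> j\<close> is the rank of \<open>\<pi> j\<close> among the remaining ones, and
  this rank grows strictly with the value.
\<close>

lemma lehmer_less_if_value_less:
  assumes "\<pi> permutes {1..n}" "\<rho> permutes {1..n}" "j \<in> {1..n}"
    and "\<forall>i \<in> {1..<j}. \<pi> i = \<rho> i" and "\<pi> j < \<rho> j"
  shows "lehmer n \<pi> j < lehmer n \<rho> j"
proof -
  have eq: "\<pi> ` {1..<j} = \<rho> ` {1..<j}" using assms(4) by (intro image_cong) auto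
  have "\<pi> j \<in> {1..n}" using permutes_in_image[OF assms(1), of j] assms(3) by simp
  moreover have "\<pi> j \<notin> \<pi> ` {1..<j}"
    by (simp add: inj_image_mem_iff[OF permutes_inj[OF assms(1)]])
  ultimately have "\<pi> j \<in> {v \<in> {1..n} - \<rho> ` {1..<j}. v < \<rho> j}" using assms(5) eq by auto
  then have "{v \<in> {1..n} - \<pi> ` {1..<j}. v < \<pi> j} \<subset> {v \<in> {1..n} - \<rho> ` {1..<j}. v < \<rho> j}"
    using assms(5) eq by auto
  then show ?thesis
    unfolding lehmer_eq_card_unused_values[OF assms(1,3)] lehmer_eq_card_unused_values[OF assms(2,3)]
    by (intro psubset_card_mono) auto
qed

lemma lehmer_inject:
  assumes "\<pi> permutes {1..n}" "\<rho> permutes {1..n}"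
    and "\<forall>j \<in> {1..n}. lehmer n \<pi> j = lehmer n \<rho> j"
  shows "\<pi> = \<rho>"
proof
  fix j
  show "\<pi> j = \<rho> j"
  proof (cases "j \<in> {1..n}")
    case False
    then show ?thesis using assms(1,2) by (simp add: permutes_def)
  next
    case True
    then show ?thesis
    proof (induction j rule: less_induct)
      case (less j)
      then have eq: "\<forall>i \<in> {1..<j}. \<pi> i = \<rho> i" by auto
      then have eq': "\<forall>i \<in> {1..<j}. \<rho> i = \<pi> i" by simp
      have "lehmer n \<pi> j = lehmer n \<rho> j" using assms(3) less.prems by blast
      then show ?case
        using lehmer_less_if_value_less[OF assms(1,2) less.prems eq]
          lehmer_less_if_value_less[OF assms(2,1) less.prems eq']
        by (cases "\<pi> j" "\<rho> j" rule: linorder_cases) auto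
    qed
  qed
qed

text \<open>
  Surjectivity comes from counting: there are \<open>n!\<close> permutations and \<open>n!\<close> candidates for a code.
\<close>

lemma bij_betw_lehmer_code:
  "bij_betw (\<lambda>\<pi>. restrict (lehmer n \<pi>) {1..n}) {\<pi>. \<pi> permutes {1..n}} (\<Pi>\<^sub>E j\<in>{1..n}. {0..n - j})"
  (is "bij_betw ?code ?S ?C")
proof -
  have inj: "inj_on ?code ?S"
  proof (rule inj_onI)
    fix \<pi> \<rho> assume "\<pi> \<in> ?S" "\<rho> \<in> ?S" "?code \<pi> = ?code \<rho>"
    moreover have "lehmer n \<pi> j = lehmer n \<rho> j" if "j \<in> {1..n}" for j
      using fun_cong[OF \<open>?code \<pi> = ?code \<rho>\<close>, of j] that by simp
    ultimately show "\<pi> = \<rho>" using lehmer_inject[of \<pi> n \<rho>] by blast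
  qed
  have sub: "?code ` ?S \<subseteq> ?C" by (auto simp: lehmer_le)
  have "card ?C = (\<Prod>j\<in>{1..n}. Suc (n - j))" by (simp add: card_PiE)
  also have "\<dots> = (\<Prod>j\<in>{1..n}. j)"
    by (rule prod.reindex_bij_witness[of _ "\<lambda>j. Suc n - j" "\<lambda>j. Suc n - j"]) auto
  also have "\<dots> = card ?S" by (simp add: card_permutations fact_prod)
  finally have "?code ` ?S = ?C"
    using sub card_image[OF inj] by (intro card_subset_eq) (auto intro: finite_PiE)
  with inj show ?thesis by (simp add: bij_betw_def)
qed

definition q_int :: "nat \<Rightarrow> int poly" where
  "q_int h = (\<Sum>i<h. monom 1 i)"

lemma q_int_0 [simp]: "q_int 0 = 0"
  by (simp add: q_int_def)

text \<open>
  This form of the recursion of \<open>q\<close>-integers mirrors the peak recursion for Dyck tilings.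
\<close>

lemma q_int_Suc: "q_int (Suc h) = monom 1 1 * q_int h + 1"
proof -
  have "q_int (Suc h) = monom 1 0 + (\<Sum>i<h. monom 1 (Suc i))"
    unfolding q_int_def by (rule sum.lessThan_Suc_shift)
  also have "(\<Sum>i<h. monom (1::int) (Suc i)) = monom 1 1 * q_int h"
    by (simp add: q_int_def sum_distrib_left mult_monom)
  finally show ?thesis by simp
qed

lemma monom_one_sum:
  assumes "finite A"
  shows "monom (1::int) (\<Sum>x\<in>A. f x) = (\<Prod>x\<in>A. monom 1 (f x))"
  using assms
proof (induction A rule: finite_induct)
  case (insert x A)
  have "monom 1 (f x + sum f A) = monom (1::int) (f x) * monom 1 (sum f A)"
    by (simp add: mult_monom)
  with insert show ?case by simp
qed simp

text \<open>
  In terms of codes the sum runs over a box, and its summand is a product over the coordinates.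
\<close>

lemma sum_inversions_lehmer_ge:
  assumes "\<And>j. j \<in> {1..n} \<Longrightarrow> c j \<le> n - j"
  shows "(\<Sum>\<pi> | \<pi> permutes {1..n} \<and> (\<forall>j\<in>{1..n}. c j \<le> lehmer n \<pi> j).
           monom 1 (inversions n \<pi> - (\<Sum>j\<in>{1..n}. c j))) = (\<Prod>j\<in>{1..n}. q_int (n - c j - j + 1))"
    (is "sum ?f ?S = _")
proof -
  let ?code = "\<lambda>\<pi>. restrict (lehmer n \<pi>) {1..n}"
  let ?C = "\<Pi>\<^sub>E j\<in>{1..n}. {c j..n - j}"
  have bij: "bij_betw ?code ?S ?C"
  proof (rule bij_betw_subset[OF bij_betw_lehmer_code])
    show "?code ` ?S = ?C"
    proof (intro equalityI subsetI)
      fix g assume g: "g \<in> ?C"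
      then have "g \<in> (\<Pi>\<^sub>E j\<in>{1..n}. {0..n - j})" by (auto simp: PiE_iff)
      then obtain \<pi> where \<pi>: "\<pi> permutes {1..n}" "g = ?code \<pi>"
        using bij_betw_imp_surj_on[OF bij_betw_lehmer_code[of n]] by blast
      moreover have "c j \<le> lehmer n \<pi> j" if "j \<in> {1..n}" for j
        using g that PiE_mem[OF g that] unfolding \<pi>(2) by simp
      ultimately show "g \<in> ?code ` ?S" by blast
    qed (auto simp: lehmer_le)
  qed auto
  have weight: "?f \<pi> = (\<Prod>j\<in>{1..n}. monom 1 (?code \<pi> j - c j))" if "\<pi> \<in> ?S" for \<pi>
  proof -
    have "(\<Sum>j\<in>{1..n}. lehmer n \<pi> j) - (\<Sum>j\<in>{1..n}. c j) = (\<Sum>j\<in>{1..n}. lehmer n \<pi> j - c j)"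
      using that by (intro sum_subtractf_nat[symmetric]) auto
    also have "\<dots> = (\<Sum>j\<in>{1..n}. ?code \<pi> j - c j)" by (intro sum.cong) auto
    finally show ?thesis by (simp only: inversions_eq_sum_lehmer monom_one_sum finite_atLeastAtMost)
  qed
  have "sum ?f ?S = (\<Sum>\<pi>\<in>?S. \<Prod>j\<in>{1..n}. monom 1 (?code \<pi> j - c j))"
    by (rule sum.cong[OF refl weight])
  also have "\<dots> = (\<Sum>g\<in>?C. \<Prod>j\<in>{1..n}. monom 1 (g j - c j))"
    by (rule sum.reindex_bij_betw[OF bij])
  also have "\<dots> = (\<Prod>j\<in>{1..n}. \<Sum>l\<in>{c j..n - j}. monom 1 (l - c j))"
    by (rule prod_sum_PiE[symmetric]) auto
  also have "\<dots> = (\<Prod>j\<in>{1..n}. q_int (n - c j - j + 1))"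
  proof (rule prod.cong)
    fix j assume "j \<in> {1..n}"
    then show "(\<Sum>l\<in>{c j..n - j}. monom 1 (l - c j)) = q_int (n - c j - j + 1)"
      unfolding q_int_def using assms[of j]
      by (intro sum.reindex_bij_witness[of _ "\<lambda>i. i + c j" "\<lambda>l. l - c j"]) auto
  qed simp
  finally show ?thesis .
qed

section \<open>The Bruhat order above a 132-avoiding permutation\<close>

text \<open>
  Swapping the positions \<open>a\<close> and \<open>b\<close> in an inversion \<open>(i, j)\<close> of \<open>u\<close> yields an inversion of
  \<open>u \<circ> transpose a b\<close>, unless the swap reverses the order of \<open>i\<close> and \<open>j\<close>; in that case \<open>(i, j)\<close>
  itself remains an inversion. This embeds the inversions of \<open>u\<close> into those of
  \<open>u \<circ> transpose a b\<close> and leaves out the new inversion \<open>(a, b)\<close>.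
\<close>

lemma inversions_transpose_less:
  assumes "a \<in> {1..n}" "b \<in> {1..n}" "a < b" "u a < u b"
  shows "inversions n u < inversions n (u \<circ> transpose a b)"
proof -
  define t where "t = transpose a b"
  define I where "I w = {(i, j). i \<in> {1..n} \<and> j \<in> {1..n} \<and> i < j \<and> w i > w j}" for w :: "nat \<Rightarrow> nat"
  define \<phi> where "\<phi> = (\<lambda>(i, j). if t i < t j then (t i, t j) else (i, j))"
  have ab: "t a = b" "t b = a" and id: "\<And>i. i \<noteq> a \<Longrightarrow> i \<noteq> b \<Longrightarrow> t i = i"
    by (auto simp: t_def transpose_def)
  have tt: "t (t i) = i" for i by (simp add: t_def)
  have tinj: "t i = t j \<longleftrightarrow> i = j" for i j using tt by metis
  have rng: "t i \<in> {1..n}" if "i \<in> {1..n}" for i using that assms(1,2) by (auto simp: t_def transpose_def)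
  have fin: "finite (I w)" for w
    by (rule finite_subset[of _ "{1..n} \<times> {1..n}"]) (auto simp: I_def)
  have inj: "inj_on \<phi> (I u)"
  proof (rule inj_onI)
    fix p r assume "p \<in> I u" "r \<in> I u" "\<phi> p = \<phi> r"
    then show "p = r" by (auto simp: \<phi>_def I_def tt tinj split: if_splits)
  qed
  have "\<phi> p \<in> I (u \<circ> t)" if pI: "p \<in> I u" for p
  proof -
    obtain i j where p: "p = (i, j)" "i \<in> {1..n}" "j \<in> {1..n}" "i < j" "u i > u j"
      using pI by (cases p) (auto simp: I_def)
    show ?thesis
    proof (cases "t i < t j")
      case True
      then show ?thesis using p rng[of i] rng[of j] by (auto simp: \<phi>_def I_def tt)
    next
      case False
      then have "u (t i) > u (t j)"
        using p(4,5) assms(3,4) unfolding t_def transpose_def by (auto split: if_splits)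
      then show ?thesis using p False by (auto simp: \<phi>_def I_def)
    qed
  qed
  then have sub: "\<phi> ` I u \<subseteq> I (u \<circ> t)" by blast
  have "(a, b) \<notin> \<phi> ` I u"
  proof
    assume "(a, b) \<in> \<phi> ` I u"
    then obtain i j where ij: "(i, j) \<in> I u" "\<phi> (i, j) = (a, b)" by auto
    show False
    proof (cases "t i < t j")
      case True
      then have "t a = i" "t b = j" using ij tt by (auto simp: \<phi>_def)
      then show False using ij ab assms(3) by (simp add: I_def)
    next
      case False
      then show False using ij assms(3,4) by (simp add: \<phi>_def I_def)
    qed
  qed
  moreover have "(a, b) \<in> I (u \<circ> t)" using assms by (auto simp: I_def ab)
  ultimately have "\<phi> ` I u \<subset> I (u \<circ> t)" using sub by blast
  then have "card (\<phi> ` I u) < card (I (u \<circ> t))" by (intro psubset_card_mono fin)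
  then show ?thesis using card_image[OF inj] by (simp add: inversions_def I_def t_def)
qed

text \<open>
  The definition of a Bruhat step compares numbers of inversions; what is used of it is that it
  creates an inversion at the two transposed positions.
\<close>

lemma bruhat_step_cases:
  assumes "bruhat_step n u v"
  obtains a b where "a \<in> {1..n}" "b \<in> {1..n}" "a < b" "u a < u b" "v = u \<circ> transpose a b"
proof -
  note result = that
  obtain a b where ab: "a \<in> {1..n}" "b \<in> {1..n}" "v = u \<circ> transpose a b"
    and less: "inversions n u < inversions n v"
    using assms by (auto simp: bruhat_step_def)
  have ordered: thesis if "c \<in> {1..n}" "d \<in> {1..n}" "c < d" "v = u \<circ> transpose c d" for c d
  proof -
    have "\<not> u d < u c"
    proof
      assume "u d < u c"
      then have "inversions n v < inversions n (v \<circ> transpose c d)"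
        using that by (intro inversions_transpose_less) auto
      moreover have "v \<circ> transpose c d = u" using that by (simp add: comp_assoc)
      ultimately show False using less by simp
    qed
    moreover have "u c \<noteq> u d"
    proof
      assume "u c = u d"
      then have "v = u" using that(4) by (auto simp: fun_eq_iff transpose_def)
      then show False using less by simp
    qed
    ultimately show thesis using that by (intro result[of c d]) auto
  qed
  consider "a < b" | "b < a" | "a = b" by linarith
  then show thesis
  proof cases
    case 1
    then show thesis using ordered ab by blast
  next
    case 2
    then show thesis using ordered[of b a] ab by (simp add: transpose_commute)
  next
    case 3
    then show thesis using ab less by simp
  qed
qed

text \<open>
  Any \<open>i > k\<close> with \<open>\<sigma> i < \<sigma> k\<close> also satisfies \<open>\<sigma> i < \<sigma> j\<close>, since otherwise \<open>j < k < i\<close> would be the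
  positions of a 132-pattern.
\<close>

lemma lehmer_antimono_if_avoids_132:
  assumes "\<sigma> permutes {1..n}" "avoids_132 n \<sigma>" "j \<in> {1..n}" "k \<in> {1..n}" "j \<le> k"
  shows "lehmer n \<sigma> k \<le> lehmer n \<sigma> j"
proof (cases "j = k")
  case False
  have "{i \<in> {k<..n}. \<sigma> i < \<sigma> k} \<subseteq> {i \<in> {j<..n}. \<sigma> i < \<sigma> j}"
  proof
    fix i assume i: "i \<in> {i \<in> {k<..n}. \<sigma> i < \<sigma> k}"
    have "\<sigma> i \<noteq> \<sigma> j" using i assms(5) inj_eq[OF permutes_inj[OF assms(1)], of i j] by auto
    moreover have "\<not> \<sigma> j < \<sigma> i"
    proof
      assume "\<sigma> j < \<sigma> i"
      moreover have "i \<in> {1..n}" "j < k" "k < i" "\<sigma> i < \<sigma> k" using i assms(5) False by auto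
      ultimately show False using assms(2-4) unfolding avoids_132_def by blast
    qed
    ultimately show "i \<in> {i \<in> {j<..n}. \<sigma> i < \<sigma> j}" using i assms(5) by auto
  qed
  then show ?thesis unfolding lehmer_def by (intro card_mono) auto
qed simp

lemma lehmer_less_value:
  assumes "\<pi> permutes {1..n}" "j \<in> {1..n}"
  shows "lehmer n \<pi> j < \<pi> j"
proof -
  have "lehmer n \<pi> j \<le> card {1..<\<pi> j}"
    unfolding lehmer_eq_card_unused_values[OF assms] by (intro card_mono) auto
  moreover have "\<pi> j \<in> {1..n}" using permutes_in_image[OF assms(1)] assms(2) by blast
  ultimately show ?thesis by auto
qed

text \<open>
  Here \<open>c j\<close> is the height of column \<open>j\<close> of a top-left justified diagram and the dots of \<open>\<pi>\<close> avoid
  that diagram. In the rows \<open>1, \<dots>, c j\<close> the diagram covers all columns up to \<open>j\<close>, so the dots of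
  these rows lie further to the right.
\<close>

lemma initial_values_unused:
  fixes c \<pi> :: "nat \<Rightarrow> nat"
  assumes anti: "\<And>j k. j \<in> {1..n} \<Longrightarrow> k \<in> {1..n} \<Longrightarrow> j \<le> k \<Longrightarrow> c k \<le> c j"
    and "c j \<le> n" and above: "\<forall>j\<in>{1..n}. c j < \<pi> j" and j: "j \<in> {1..n}"
  shows "{1..c j} \<subseteq> {v \<in> {1..n} - \<pi> ` {1..<j}. v < \<pi> j}"
proof
  fix v assume v: "v \<in> {1..c j}"
  have "v \<notin> \<pi> ` {1..<j}"
  proof
    assume "v \<in> \<pi> ` {1..<j}"
    then obtain i where i: "i \<in> {1..<j}" "v = \<pi> i" by blast
    then have "i \<in> {1..n}" using j by simp
    then have "c j \<le> c i" "c i < \<pi> i" using i j above by (auto intro: anti)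
    then show False using v i by simp
  qed
  moreover have "c j < \<pi> j" using above j by blast
  ultimately show "v \<in> {v \<in> {1..n} - \<pi> ` {1..<j}. v < \<pi> j}" using v assms(2) by simp
qed

text \<open>
  Being above \<open>\<sigma>\<close> in Bruhat order amounts to the condition on the right (the dots of \<open>\<pi>\<close> avoid the
  diagram with column heights \<open>c\<close>), whereas the generating function is computed from the
  condition on the left. The two agree because the diagram is top-left justified.
\<close>

lemma lehmer_ge_iff_values_greater:
  assumes "\<pi> permutes {1..n}"
    and anti: "\<And>j k. j \<in> {1..n} \<Longrightarrow> k \<in> {1..n} \<Longrightarrow> j \<le> k \<Longrightarrow> c k \<le> c j"
    and bound: "\<And>j. j \<in> {1..n} \<Longrightarrow> c j \<le> n"
  shows "(\<forall>j\<in>{1..n}. c j \<le> lehmer n \<pi> j) \<longleftrightarrow> (\<forall>j\<in>{1..n}. c j < \<pi> j)"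
proof
  assume "\<forall>j\<in>{1..n}. c j \<le> lehmer n \<pi> j"
  then show "\<forall>j\<in>{1..n}. c j < \<pi> j"
    using lehmer_less_value[OF assms(1)] by (meson le_less_trans)
next
  assume above: "\<forall>j\<in>{1..n}. c j < \<pi> j"
  show "\<forall>j\<in>{1..n}. c j \<le> lehmer n \<pi> j"
  proof
    fix j assume j: "j \<in> {1..n}"
    have "card {1..c j} \<le> lehmer n \<pi> j"
      unfolding lehmer_eq_card_unused_values[OF assms(1) j]
      by (intro card_mono initial_values_unused anti bound above j) auto
    then show "c j \<le> lehmer n \<pi> j" by simp
  qed
qed

text \<open>
  As long as \<open>\<pi>\<close> has an inversion \<open>(a, b)\<close> whose cross, in row \<open>\<pi> b\<close> and column \<open>a\<close>, lies outside
  the diagram of \<open>\<sigma>\<close>, undoing it gives a smaller permutation that still avoids the diagram. If all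
  crosses of \<open>\<pi>\<close> lie in the diagram, then the code of \<open>\<pi>\<close> is at most, hence equal to, that of \<open>\<sigma>\<close>.
\<close>

lemma bruhat_le_if_values_greater:
  assumes "\<sigma> permutes {1..n}" "avoids_132 n \<sigma>"
    and "\<pi> permutes {1..n}" "\<forall>j\<in>{1..n}. lehmer n \<sigma> j < \<pi> j"
  shows "bruhat_le n \<sigma> \<pi>"
  using assms(3,4)
proof (induction "inversions n \<pi>" arbitrary: \<pi> rule: less_induct)
  case less
  let ?c = "lehmer n \<sigma>"
  have anti: "?c k \<le> ?c j" if "j \<in> {1..n}" "k \<in> {1..n}" "j \<le> k" for j k
    using lehmer_antimono_if_avoids_132[OF assms(1,2) that] .
  have bound: "?c j \<le> n" for j using lehmer_le[of n \<sigma> j] by simp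
  show ?case
  proof (cases "\<exists>a\<in>{1..n}. \<exists>b\<in>{1..n}. a < b \<and> \<pi> b < \<pi> a \<and> ?c a < \<pi> b")
    case True
    then obtain a b where ab: "a \<in> {1..n}" "b \<in> {1..n}" "a < b" "\<pi> b < \<pi> a" "?c a < \<pi> b" by blast
    define \<rho> where "\<rho> = \<pi> \<circ> transpose a b"
    have \<rho>\<pi>: "\<rho> \<circ> transpose a b = \<pi>" by (simp add: \<rho>_def comp_assoc)
    have "\<rho> a < \<rho> b" using ab by (simp add: \<rho>_def)
    then have less_inv: "inversions n \<rho> < inversions n \<pi>"
      using inversions_transpose_less[OF ab(1-3), of \<rho>] \<rho>\<pi> by simp
    have "\<rho> permutes {1..n}"
      unfolding \<rho>_def using less.prems(1) ab(1,2) by (intro permutes_compose permutes_swap_id) auto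
    moreover have "\<forall>j\<in>{1..n}. ?c j < \<rho> j"
    proof
      fix j assume j: "j \<in> {1..n}"
      have "?c b \<le> ?c a" using ab by (intro anti) auto
      then show "?c j < \<rho> j" using less.prems(2) j ab by (auto simp: \<rho>_def transpose_def)
    qed
    ultimately have "bruhat_le n \<sigma> \<rho>" using less.hyps[OF less_inv] by blast
    moreover have "bruhat_step n \<rho> \<pi>"
      unfolding bruhat_step_def using ab \<rho>\<pi> less_inv by metis
    ultimately show ?thesis unfolding bruhat_le_def by auto
  next
    case False
    have ge: "\<forall>j\<in>{1..n}. ?c j \<le> lehmer n \<pi> j"
      using lehmer_ge_iff_values_greater[of \<pi> n ?c, OF less.prems(1) anti bound] less.prems(2) by blast
    have "lehmer n \<sigma> j = lehmer n \<pi> j" if j: "j \<in> {1..n}" for j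
    proof -
      have "{v \<in> {1..n} - \<pi> ` {1..<j}. v < \<pi> j} \<subseteq> {1..?c j}"
      proof
        fix v assume v: "v \<in> {v \<in> {1..n} - \<pi> ` {1..<j}. v < \<pi> j}"
        then have "v \<in> \<pi> ` {1..n}" using permutes_image[OF less.prems(1)] by simp
        then obtain k where k: "k \<in> {1..n}" "v = \<pi> k" by blast
        have "k \<noteq> j" using v k by blast
        moreover have "k \<notin> {1..<j}" using v k by blast
        ultimately have "j < k" using k by simp
        then show "v \<in> {1..?c j}" using False j k v by (metis (no_types, lifting) DiffD1 atLeastAtMost_iff mem_Collect_eq not_less)
      qed
      then have "lehmer n \<pi> j \<le> card {1..?c j}"
        unfolding lehmer_eq_card_unused_values[OF less.prems(1) j] by (intro card_mono) auto
      with ge j show ?thesis by (simp add: le_antisym)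
    qed
    then have "\<sigma> = \<pi>" using lehmer_inject[OF assms(1) less.prems(1)] by blast
    then show ?thesis by (simp add: bruhat_le_def)
  qed
qed

text \<open>
  A step upwards replaces the dots \<open>(u a, a)\<close> and \<open>(u b, b)\<close> by \<open>(u b, a)\<close> and \<open>(u a, b)\<close>. Both are
  below or to the right of \<open>(u a, a)\<close>, which is outside the diagram.
\<close>

lemma values_greater_if_bruhat_le:
  assumes anti: "\<And>j k. j \<in> {1..n} \<Longrightarrow> k \<in> {1..n} \<Longrightarrow> j \<le> k \<Longrightarrow> c k \<le> c j"
    and "bruhat_le n \<sigma> \<pi>" and "\<forall>j\<in>{1..n}. c j < \<sigma> j"
  shows "\<forall>j\<in>{1..n}. c j < \<pi> j"
  using assms(2) unfolding bruhat_le_def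
proof (induction rule: rtranclp_induct)
  case base
  show ?case by (rule assms(3))
next
  case (step u v)
  obtain a b where ab: "a \<in> {1..n}" "b \<in> {1..n}" "a < b" "u a < u b" "v = u \<circ> transpose a b"
    using bruhat_step_cases[OF step.hyps(2)] .
  have "c b \<le> c a" using ab by (intro anti) auto
  then show ?case
    using step.IH ab by (auto simp: transpose_def intro: le_less_trans less_trans)
qed

theorem bruhat_le_iff_lehmer_le:
  assumes "\<sigma> permutes {1..n}" "avoids_132 n \<sigma>" "\<pi> permutes {1..n}"
  shows "bruhat_le n \<sigma> \<pi> \<longleftrightarrow> (\<forall>j\<in>{1..n}. lehmer n \<sigma> j \<le> lehmer n \<pi> j)"
proof -
  have anti: "lehmer n \<sigma> k \<le> lehmer n \<sigma> j" if "j \<in> {1..n}" "k \<in> {1..n}" "j \<le> k" for j k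
    using lehmer_antimono_if_avoids_132[OF assms(1,2) that] .
  have bound: "lehmer n \<sigma> j \<le> n" for j using lehmer_le[of n \<sigma> j] by simp
  have "bruhat_le n \<sigma> \<pi> \<longleftrightarrow> (\<forall>j\<in>{1..n}. lehmer n \<sigma> j < \<pi> j)"
    using values_greater_if_bruhat_le[of n "lehmer n \<sigma>", OF anti, of \<sigma> \<pi>]
      lehmer_less_value[OF assms(1)] bruhat_le_if_values_greater[OF assms] by blast
  also have "\<dots> \<longleftrightarrow> (\<forall>j\<in>{1..n}. lehmer n \<sigma> j \<le> lehmer n \<pi> j)"
    using lehmer_ge_iff_values_greater[of \<pi> n "lehmer n \<sigma>", OF assms(3) anti bound] by simp
  finally show ?thesis .
qed

text \<open>
  One inclusion is \<open>initial_values_unused\<close> for the code of \<open>\<sigma>\<close> itself, and both sides have the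
  same cardinality.
\<close>

lemma unused_smaller_values_if_avoids_132:
  assumes "\<sigma> permutes {1..n}" "avoids_132 n \<sigma>" "j \<in> {1..n}"
  shows "{v \<in> {1..n} - \<sigma> ` {1..<j}. v < \<sigma> j} = {1..lehmer n \<sigma> j}"
proof -
  have "{1..lehmer n \<sigma> j} \<subseteq> {v \<in> {1..n} - \<sigma> ` {1..<j}. v < \<sigma> j}"
  proof (rule initial_values_unused)
    show "lehmer n \<sigma> j \<le> n" using lehmer_le[of n \<sigma> j] by simp
  qed (use lehmer_antimono_if_avoids_132[OF assms(1,2)] lehmer_less_value[OF assms(1)] assms(3) in blast)+
  moreover have "card {1..lehmer n \<sigma> j} = card {v \<in> {1..n} - \<sigma> ` {1..<j}. v < \<sigma> j}"
    using lehmer_eq_card_unused_values[OF assms(1,3)] by simp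
  ultimately show ?thesis by (intro card_subset_eq[symmetric]) auto
qed

lemma crosses_if_avoids_132:
  assumes "\<sigma> permutes {1..n}" "avoids_132 n \<sigma>"
  shows "crosses n \<sigma> = {(i, j). i \<in> {1..n} \<and> j \<in> {1..n} \<and> i \<le> lehmer n \<sigma> j}"
proof -
  have iff: "(i, j) \<in> crosses n \<sigma> \<longleftrightarrow> i \<le> lehmer n \<sigma> j" if ij: "i \<in> {1..n}" "j \<in> {1..n}" for i j
  proof -
    have "\<sigma> j \<in> {1..n}" using permutes_in_image[OF assms(1)] ij by blast
    have "(\<exists>k>j. k \<in> {1..n} \<and> \<sigma> k = i) \<longleftrightarrow> i \<notin> \<sigma> ` {1..<j}" if "i < \<sigma> j"
    proof
      assume "\<exists>k>j. k \<in> {1..n} \<and> \<sigma> k = i"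
      then obtain k where k: "k > j" "i = \<sigma> k" by blast
      show "i \<notin> \<sigma> ` {1..<j}"
        unfolding k(2) inj_image_mem_iff[OF permutes_inj[OF assms(1)]] using k(1) by simp
    next
      assume unused: "i \<notin> \<sigma> ` {1..<j}"
      have "i \<in> \<sigma> ` {1..n}" using permutes_image[OF assms(1)] ij by simp
      then obtain k where k: "k \<in> {1..n}" "i = \<sigma> k" by blast
      moreover have "k \<noteq> j" using k that by blast
      moreover have "k \<notin> {1..<j}" using k unused by blast
      ultimately show "\<exists>k>j. k \<in> {1..n} \<and> \<sigma> k = i" by (intro exI[of _ k]) auto
    qed
    then have "(i, j) \<in> crosses n \<sigma> \<longleftrightarrow> i \<in> {v \<in> {1..n} - \<sigma> ` {1..<j}. v < \<sigma> j}"
      using ij \<open>\<sigma> j \<in> {1..n}\<close> by (auto simp: crosses_def dots_def)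
    then show ?thesis
      unfolding unused_smaller_values_if_avoids_132[OF assms ij(2)] using ij by simp
  qed
  moreover have "crosses n \<sigma> \<subseteq> {1..n} \<times> {1..n}" by (auto simp: crosses_def)
  ultimately show ?thesis by fast
qed

lemma sum_bruhat_ge:
  assumes "\<sigma> permutes {1..n}" "avoids_132 n \<sigma>"
  shows "(\<Sum>\<pi> | \<pi> permutes {1..n} \<and> bruhat_le n \<sigma> \<pi>. monom 1 (inversions n \<pi> - inversions n \<sigma>))
       = (\<Prod>j\<in>{1..n}. q_int (n - lehmer n \<sigma> j - j + 1))"
proof -
  have "{\<pi>. \<pi> permutes {1..n} \<and> bruhat_le n \<sigma> \<pi>}
      = {\<pi>. \<pi> permutes {1..n} \<and> (\<forall>j\<in>{1..n}. lehmer n \<sigma> j \<le> lehmer n \<pi> j)}"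
    using bruhat_le_iff_lehmer_le[OF assms] by blast
  then show ?thesis
    using sum_inversions_lehmer_ge[of n "lehmer n \<sigma>", OF lehmer_le]
    by (simp only: inversions_eq_sum_lehmer[of n \<sigma>])
qed

section \<open>Lattice paths in terms of their down steps\<close>

text \<open>
  The \<open>k\<close>-th vertex lies on the antidiagonal \<open>x + y = k\<close>, so its first coordinate determines it.
  Conditions on paths and cells thereby become inequalities between natural numbers; a larger
  value of \<open>downs\<close> means a lower path.
\<close>

definition downs :: "step list \<Rightarrow> nat \<Rightarrow> nat" where
  "downs p k = count_list (take k p) Down"

lemma downs_0 [simp]: "downs p 0 = 0"
  by (simp add: downs_def)

lemma downs_Suc: "k < length p \<Longrightarrow> downs p (Suc k) = downs p k + (if p ! k = Down then 1 else 0)"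
  by (simp add: downs_def take_Suc_conv_app_nth)

lemma downs_ge_length: "length p \<le> k \<Longrightarrow> downs p k = count_list p Down"
  by (simp add: downs_def)

lemma downs_Suc_le: "downs p (Suc k) \<le> Suc (downs p k)"
  by (cases "k < length p") (simp_all add: downs_Suc downs_ge_length)

lemma downs_mono: "k \<le> l \<Longrightarrow> downs p k \<le> downs p l"
proof (induction l rule: dec_induct)
  case (step l)
  have "downs p l \<le> downs p (Suc l)"
    by (cases "l < length p") (simp_all add: downs_Suc downs_ge_length)
  with step show ?case by simp
qed simp

lemma downs_le: "downs p k \<le> k"
  by (induction k) (use downs_Suc_le[of p] in \<open>auto intro: le_trans\<close>)

lemma downs_append: "downs (p @ q) k = downs p k + downs q (k - length p)"
  by (simp add: downs_def)

lemma count_up_down: "count_list p Up + count_list p Down = length p"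
proof (induction p)
  case (Cons s p)
  then show ?case by (cases s) auto
qed simp

lemma vertex_eq: "k \<le> length p \<Longrightarrow> vertex p k = (int (downs p k), int k - int (downs p k))"
  using count_up_down[of "take k p"] by (simp add: vertex_def downs_def)

lemma lattice_path_iff: "lattice_path n p \<longleftrightarrow> length p = 2 * n \<and> downs p (2 * n) = n"
  using count_up_down[of p] by (auto simp: lattice_path_def vertex_def downs_def)

lemma dyck_path_iff:
  "dyck_path n p \<longleftrightarrow> length p = 2 * n \<and> downs p (2 * n) = n \<and> (\<forall>k\<le>2 * n. 2 * downs p k \<le> k)"
proof -
  have "(\<forall>(x, y)\<in>vertices p. x \<le> y) \<longleftrightarrow> (\<forall>k\<le>length p. 2 * downs p k \<le> k)"
    by (force simp: vertices_def vertex_eq)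
  then show ?thesis unfolding dyck_path_def lattice_path_iff by auto
qed

text \<open>
  The count of down steps grows by at most one per step, so it takes every intermediate value.
\<close>

lemma exists_down_step:
  assumes "a < downs p t"
  obtains k where "k < t" "k < length p" "p ! k = Down" "downs p k = a"
proof -
  have "\<exists>k<t. k < length p \<and> p ! k = Down \<and> downs p k = a"
    using assms
  proof (induction t)
    case (Suc t)
    show ?case
    proof (cases "a < downs p t")
      case True
      then show ?thesis using Suc.IH by (meson less_SucI)
    next
      case False
      then have neq: "downs p (Suc t) \<noteq> downs p t" using Suc.prems by linarith
      then have "t < length p" by (rule contrapos_np) (simp add: downs_ge_length)
      then show ?thesis
        using neq False Suc.prems by (intro exI[of _ t]) (auto simp: downs_Suc split: if_splits)
    qed
  qed simp
  then show thesis using that by blast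
qed

text \<open>
  The cell \<open>(a, b)\<close> has its diagonal from upper left to lower right on the antidiagonal
  \<open>x + y = a + b + 1\<close>, which is met by the path in a single vertex. The cell is above or below the
  path according to the side on which this vertex lies.
\<close>

lemma cell_above_iff:
  "cell_above p (a, b) \<longleftrightarrow> 0 \<le> a \<and> a < int (downs p (nat (a + b + 1)))"
proof
  assume "cell_above p (a, b)"
  then obtain k where k: "k < length p" "p ! k = Down" "vertex p k = (a, int k - a)" "int k - a \<le> b"
    by (auto simp: cell_above_def down_step_at_def vertex_eq)
  then have "a = int (downs p k)" by (simp add: vertex_eq)
  moreover have "downs p (Suc k) \<le> downs p (nat (a + b + 1))"
    using k by (intro downs_mono) linarith
  ultimately show "0 \<le> a \<and> a < int (downs p (nat (a + b + 1)))" using k by (simp add: downs_Suc)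
next
  assume a: "0 \<le> a \<and> a < int (downs p (nat (a + b + 1)))"
  then have "nat a < downs p (nat (a + b + 1))" by linarith
  then obtain k where k: "k < nat (a + b + 1)" "k < length p" "p ! k = Down" "downs p k = nat a"
    by (rule exists_down_step)
  then have "down_step_at p a (int k - a)"
    unfolding down_step_at_def using a by (intro exI[of _ k]) (simp add: vertex_eq)
  moreover have "int k - a \<le> b" using k by linarith
  ultimately show "cell_above p (a, b)" by (auto simp: cell_above_def)
qed

lemma cell_below_iff:
  "cell_below p (a, b) \<longleftrightarrow>
     0 \<le> a \<and> a < int (downs p (length p)) \<and> int (downs p (nat (a + b + 1))) \<le> a"
proof
  assume "cell_below p (a, b)"
  then obtain k where k: "k < length p" "p ! k = Down" "vertex p k = (a, int k - a)" "b + 1 \<le> int k - a"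
    by (auto simp: cell_below_def down_step_at_def vertex_eq)
  then have "a = int (downs p k)" by (simp add: vertex_eq)
  moreover have "downs p (nat (a + b + 1)) \<le> downs p k"
    using k by (intro downs_mono) linarith
  moreover have "downs p (Suc k) \<le> downs p (length p)" using k by (intro downs_mono) simp
  ultimately show "0 \<le> a \<and> a < int (downs p (length p)) \<and> int (downs p (nat (a + b + 1))) \<le> a"
    using k by (simp add: downs_Suc)
next
  assume a: "0 \<le> a \<and> a < int (downs p (length p)) \<and> int (downs p (nat (a + b + 1))) \<le> a"
  then have "nat a < downs p (length p)" by linarith
  then obtain k where k: "k < length p" "p ! k = Down" "downs p k = nat a"
    by (rule exists_down_step)
  then have "down_step_at p a (int k - a)"
    unfolding down_step_at_def using a by (intro exI[of _ k]) (simp add: vertex_eq)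
  moreover have "b + 1 \<le> int k - a"
  proof (rule ccontr)
    assume "\<not> b + 1 \<le> int k - a"
    then have "downs p (Suc k) \<le> downs p (nat (a + b + 1))" by (intro downs_mono) linarith
    then have "Suc (nat a) \<le> downs p (nat (a + b + 1))" using k by (simp add: downs_Suc)
    then show False using a by linarith
  qed
  ultimately show "cell_below p (a, b)" by (auto simp: cell_below_def)
qed

lemma path_eqI:
  assumes "length p = length p'" "\<And>t. downs p t = downs p' t"
  shows "p = p'"
proof (rule nth_equalityI)
  fix k assume k: "k < length p"
  then have "p ! k = Down \<longleftrightarrow> p' ! k = Down"
    using assms(1) assms(2)[of "Suc k"] assms(2)[of k] by (simp add: downs_Suc split: if_splits)
  then show "p ! k = p' ! k" by (cases "p ! k"; cases "p' ! k") auto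
qed (rule assms(1))

text \<open>
  The cells above a path determine on each antidiagonal where the path crosses it. Antidiagonal
  positions not seen by a cell of the grid are settled by the bounds on the numbers of up and
  down steps.
\<close>

lemma lattice_path_eqI:
  assumes "lattice_path n p" "lattice_path n p'"
    and cells: "\<And>c. c \<in> grid_cell n ` ({1..n} \<times> {1..n}) \<Longrightarrow> cell_above p c \<longleftrightarrow> cell_above p' c"
  shows "p = p'"
proof (rule path_eqI)
  have len: "length p = 2 * n" "length p' = 2 * n" and tot: "downs p (2 * n) = n" "downs p' (2 * n) = n"
    using assms(1,2) by (auto simp: lattice_path_iff)
  show "length p = length p'" using len by simp
  fix t
  have bounds: "downs r t \<le> min t n \<and> t \<le> n + downs r t" if "lattice_path n r" "t \<le> 2 * n" for r
  proof -
    have "count_list (take t r) Up \<le> count_list r Up"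
      using count_list_append[of "take t r" "drop t r" Up] by simp
    moreover have "count_list r Up = n" using that(1) by (simp add: lattice_path_def vertex_def)
    moreover have "downs r t \<le> downs r (2 * n)" using that by (intro downs_mono)
    ultimately show ?thesis
      using that count_up_down[of "take t r"] downs_le[of r t] by (auto simp: lattice_path_iff downs_def)
  qed
  have "a < downs p t \<longleftrightarrow> a < downs p' t" if t: "t \<le> 2 * n" for a
  proof (cases "a < n \<and> a < t \<and> t - a \<le> n")
    case True
    \<comment> \<open>The cell in column \<open>a + 1\<close> that decides the question lies in row \<open>i\<close>.\<close>
    define i where "i = n + a + 1 - t"
    have i: "i \<in> {1..n}" "int n - int i = int t - int a - 1" using True t by (auto simp: i_def)
    then have "(int a, int t - int a - 1) \<in> grid_cell n ` ({1..n} \<times> {1..n})"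
      using True by (intro image_eqI[of _ _ "(i, a + 1)"]) (auto simp: grid_cell_def)
    from cells[OF this] show ?thesis by (simp add: cell_above_iff)
  next
    case False
    then show ?thesis using bounds[OF assms(1) t] bounds[OF assms(2) t] by linarith
  qed
  then have "downs p t = downs p' t" if "t \<le> 2 * n" using that by (metis nat_neq_iff)
  moreover have "downs p t = downs p' t" if "\<not> t \<le> 2 * n"
    using that len tot downs_ge_length[of p t] downs_ge_length[of p' t]
      downs_ge_length[of p "2 * n"] downs_ge_length[of p' "2 * n"] by simp
  ultimately show "downs p t = downs p' t" by blast
qed

lemma down_step_at_append:
  "down_step_at (p @ q) a y \<longleftrightarrow> down_step_at p a y \<or>
     down_step_at q (a - int (count_list p Down)) (y - int (count_list p Up))"
proof -
  have "down_step_at (p @ q) a y \<longleftrightarrow>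
    (\<exists>k<length p. (p @ q) ! k = Down \<and> vertex (p @ q) k = (a, y)) \<or>
    (\<exists>k<length q. (p @ q) ! (length p + k) = Down \<and> vertex (p @ q) (length p + k) = (a, y))"
    (is "?L \<longleftrightarrow> ?A \<or> ?B")
  proof
    assume ?L
    then obtain k where k: "k < length p + length q" "(p @ q) ! k = Down" "vertex (p @ q) k = (a, y)"
      by (auto simp: down_step_at_def)
    show "?A \<or> ?B"
    proof (cases "k < length p")
      case False
      then have "k = length p + (k - length p)" "k - length p < length q" using k by auto
      then show ?thesis using k by metis
    qed (use k in blast)
  next
    assume "?A \<or> ?B"
    then show ?L
    proof
      assume ?A
      then show ?L unfolding down_step_at_def by (metis length_append trans_less_add1)
    next
      assume ?B
      then obtain k where "k < length q" "(p @ q) ! (length p + k) = Down"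
        "vertex (p @ q) (length p + k) = (a, y)" by blast
      then show ?L unfolding down_step_at_def by (intro exI[of _ "length p + k"]) simp
    qed
  qed
  also have "?A \<longleftrightarrow> down_step_at p a y"
    by (auto simp: down_step_at_def vertex_def nth_append)
  also have "?B \<longleftrightarrow> down_step_at q (a - int (count_list p Down)) (y - int (count_list p Up))"
    by (auto simp: down_step_at_def vertex_def)
  finally show ?thesis .
qed

lemma down_step_at_block:
  "down_step_at (replicate i Up @ [Down]) a y \<longleftrightarrow> a = 0 \<and> y = int i"
proof -
  have "\<not> down_step_at (replicate i Up) a y" by (auto simp: down_step_at_def)
  moreover have "count_list (replicate i Up) x = (if x = Up then i else 0)" for x
    by (induction i) auto
  moreover have "down_step_at [Down] x z \<longleftrightarrow> x = 0 \<and> z = 0" for x z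
    by (auto simp: down_step_at_def vertex_def)
  ultimately show ?thesis by (auto simp: down_step_at_append)
qed

lemma dyck_pathI:
  assumes "lattice_path n p" "\<And>a y. down_step_at p a y \<Longrightarrow> a + 1 \<le> y"
  shows "dyck_path n p"
proof -
  have len: "length p = 2 * n" using assms(1) by (simp add: lattice_path_iff)
  have "2 * downs p k \<le> k" if "k \<le> 2 * n" for k
    using that
  proof (induction k)
    case (Suc k)
    show ?case
    proof (cases "p ! k")
      case Up
      then show ?thesis using Suc len by (simp add: downs_Suc)
    next
      case Down
      then have "down_step_at p (int (downs p k)) (int k - int (downs p k))"
        unfolding down_step_at_def using Suc.prems len by (intro exI[of _ k]) (simp add: vertex_eq)
      from assms(2)[OF this] show ?thesis using Suc.prems len Down by (simp add: downs_Suc)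
    qed
  qed simp
  then show ?thesis using assms(1) by (simp add: dyck_path_iff lattice_path_iff)
qed

section \<open>The path of a 132-avoiding permutation\<close>

text \<open>
  The path whose \<open>j\<close>-th down step is at height \<open>h j\<close>, for a weakly increasing \<open>h\<close> with \<open>h 0 = 0\<close>.
  The value at \<open>0\<close> serves as the starting height of the path.
\<close>

primrec stair :: "(nat \<Rightarrow> nat) \<Rightarrow> nat \<Rightarrow> step list" where
  "stair h 0 = []"
| "stair h (Suc m) = stair h m @ replicate (h (Suc m) - h m) Up @ [Down]"

text \<open>
  Each down step contributes the \<open>q\<close>-integer of its starting height above the diagonal; the path is
  taken to begin at height \<open>h\<close> above the diagonal.
\<close>

fun height_weight :: "nat \<Rightarrow> step list \<Rightarrow> int poly" where
  "height_weight h [] = 1"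
| "height_weight h (Up # p) = height_weight (Suc h) p"
| "height_weight h (Down # p) = q_int h * height_weight (h - 1) p"

lemma height_weight_replicate_Up: "height_weight h (replicate i Up @ p) = height_weight (h + i) p"
  by (induction i arbitrary: h) auto

context
  fixes h :: "nat \<Rightarrow> nat" and m :: nat
  assumes h_mono: "\<And>j. j < m \<Longrightarrow> h j \<le> h (Suc j)" and h_0: "h 0 = 0"
begin

lemma count_stair: "l \<le> m \<Longrightarrow> count_list (stair h l) Down = l \<and> count_list (stair h l) Up = h l"
proof (induction l)
  case (Suc l)
  have "count_list (replicate i Up) x = (if x = Up then i else 0)" for x i
    by (induction i) auto
  then show ?case using Suc h_mono[of l] by simp
qed (simp add: h_0)

lemma down_step_at_stair:
  "l \<le> m \<Longrightarrow> down_step_at (stair h l) a y \<longleftrightarrow> (\<exists>j<l. a = int j \<and> y = int (h (Suc j)))"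
proof (induction l)
  case 0
  show ?case by (simp add: down_step_at_def)
next
  case (Suc l)
  then have "down_step_at (stair h (Suc l)) a y \<longleftrightarrow>
      (\<exists>j<l. a = int j \<and> y = int (h (Suc j))) \<or> a = int l \<and> y = int (h (Suc l))"
    using count_stair[of l] h_mono[of l] by (auto simp: down_step_at_append[of "stair h l"] down_step_at_block)
  then show ?case by (auto simp: less_Suc_eq)
qed

lemma height_weight_stair:
  assumes above: "\<And>j. j \<in> {1..m} \<Longrightarrow> j \<le> h j"
  shows "l \<le> m \<Longrightarrow> height_weight 0 (stair h l @ r) = (\<Prod>j\<in>{1..l}. q_int (h j - j + 1)) * height_weight (h l - l) r"
proof (induction l arbitrary: r)
  case 0
  show ?case by (simp add: h_0)
next
  case (Suc l)
  have "l \<le> h l" using above[of l] Suc.prems by (cases l) auto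
  moreover have "Suc l \<le> h (Suc l)" "h l \<le> h (Suc l)" using above[of "Suc l"] h_mono[of l] Suc.prems by auto
  ultimately have "h l - l + (h (Suc l) - h l) = h (Suc l) - Suc l + 1" by linarith
  then show ?case using Suc by (simp add: height_weight_replicate_Up mult.assoc)
qed

end

text \<open>
  The crosses in column \<open>j\<close> occupy its top \<open>lehmer n \<sigma> j\<close> cells, so the path below them crosses that
  column at height \<open>n - lehmer n \<sigma> j\<close>. It stays above the diagonal because \<open>lehmer n \<sigma> j \<le> n - j\<close>.
\<close>

theorem alpha_eq_stair:
  assumes \<sigma>: "\<sigma> permutes {1..n}" "avoids_132 n \<sigma>"
  defines "h \<equiv> \<lambda>j. if j = 0 then 0 else n - lehmer n \<sigma> j"
  shows "alpha n \<sigma> = stair h n"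
    and "dyck_path n (stair h n)"
    and "height_weight 0 (stair h n) = (\<Prod>j\<in>{1..n}. q_int (n - lehmer n \<sigma> j - j + 1))"
proof -
  have mono: "h j \<le> h (Suc j)" if "j < n" for j
    using that lehmer_antimono_if_avoids_132[OF \<sigma>, of j "Suc j"] by (auto simp: h_def intro: diff_le_mono2)
  have h0: "h 0 = 0" by (simp add: h_def)
  have above: "j \<le> h j" if "j \<in> {1..n}" for j
    using that lehmer_le[of n \<sigma> j] by (auto simp: h_def)
  have hn: "h n = n" using lehmer_le[of n \<sigma> n] by (simp add: h_def)
  note down = down_step_at_stair[of n h, OF mono h0 order_refl]
  have lattice: "lattice_path n (stair h n)"
    using count_stair[of n h, OF mono h0 order_refl] hn count_up_down[of "stair h n"]
    by (simp add: lattice_path_def vertex_def)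
  then show "dyck_path n (stair h n)"
  proof (rule dyck_pathI)
    fix a y assume "down_step_at (stair h n) a y"
    then obtain j where "j < n" "a = int j" "y = int (h (Suc j))" using down by auto
    then show "a + 1 \<le> y" using above[of "Suc j"] by simp
  qed
  show "height_weight 0 (stair h n) = (\<Prod>j\<in>{1..n}. q_int (n - lehmer n \<sigma> j - j + 1))"
    using height_weight_stair[of n h n "[]", OF mono h0 above order_refl]
    by (auto simp: h_def intro: prod.cong)
  have stair_cell: "cell_above (stair h n) (grid_cell n (i, j)) \<longleftrightarrow> (i, j) \<in> crosses n \<sigma>"
    if "i \<in> {1..n}" "j \<in> {1..n}" for i j
  proof -
    have "cell_above (stair h n) (grid_cell n (i, j)) \<longleftrightarrow> int (h j) \<le> int n - int i"
    proof
      assume "cell_above (stair h n) (grid_cell n (i, j))"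
      then obtain l where "int j - 1 = int l" "int (h (Suc l)) \<le> int n - int i"
        by (auto simp: cell_above_def grid_cell_def down)
      moreover from this(1) have "Suc l = j" by linarith
      ultimately show "int (h j) \<le> int n - int i" by simp
    next
      assume "int (h j) \<le> int n - int i"
      moreover have "\<exists>l<n. int j - 1 = int l \<and> int (h j) = int (h (Suc l))"
        using that by (intro exI[of _ "j - 1"]) auto
      ultimately show "cell_above (stair h n) (grid_cell n (i, j))"
        unfolding cell_above_def grid_cell_def by (auto simp: down)
    qed
    also have "\<dots> \<longleftrightarrow> i \<le> lehmer n \<sigma> j"
      using that lehmer_le[of n \<sigma> j] by (auto simp: h_def)
    finally show ?thesis using that by (simp add: crosses_if_avoids_132[OF \<sigma>])
  qed
  have "crosses n \<sigma> \<subseteq> {1..n} \<times> {1..n}" by (auto simp: crosses_def)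
  then have cells: "{c \<in> grid_cell n ` ({1..n} \<times> {1..n}). cell_above (stair h n) c} = grid_cell n ` crosses n \<sigma>"
    using stair_cell by auto
  show "alpha n \<sigma> = stair h n"
    unfolding alpha_def
  proof (rule the_equality)
    show "lattice_path n (stair h n) \<and>
      {c \<in> grid_cell n ` ({1..n} \<times> {1..n}). cell_above (stair h n) c} = grid_cell n ` crosses n \<sigma>"
      using lattice cells by blast
  next
    fix p
    assume p: "lattice_path n p \<and>
      {c \<in> grid_cell n ` ({1..n} \<times> {1..n}). cell_above p c} = grid_cell n ` crosses n \<sigma>"
    show "p = stair h n"
    proof (rule lattice_path_eqI)
      show "lattice_path n p" "lattice_path n (stair h n)" using p lattice by auto
      show "cell_above p c \<longleftrightarrow> cell_above (stair h n) c" if "c \<in> grid_cell n ` ({1..n} \<times> {1..n})" for c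
        using that p cells by blast
    qed
  qed
qed

section \<open>Dyck tilings and cover-inclusivity\<close>

definition slide :: "cell \<Rightarrow> cell" where
  "slide c = (fst c + 1, snd c - 1)"

text \<open>
  In this form cover-inclusivity refers only to the region that is tiled, so it can be transported
  along maps between regions without reference to the paths.
\<close>

definition cover_inclusive_in :: "cell set \<Rightarrow> cell set set \<Rightarrow> bool" where
  "cover_inclusive_in R D \<longleftrightarrow>
    (\<forall>\<eta>\<in>D. slide ` \<eta> \<inter> R = {} \<or> (\<exists>\<eta>'\<in>D. \<eta>' \<noteq> \<eta> \<and> slide ` \<eta> \<subseteq> \<eta>'))"

lemma translate_slide: "translate (1, -1) X = slide ` X"
  unfolding translate_def by (intro image_cong) (auto simp: slide_def)

lemma mem_region_iff:
  assumes "dyck_path n lam" "dyck_path n \<mu>"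
  shows "(a, b) \<in> region lam \<mu> \<longleftrightarrow>
    int (downs \<mu> (nat (a + b + 1))) \<le> a \<and> a < int (downs lam (nat (a + b + 1)))"
proof -
  have "downs lam t \<le> n" for t
    using assms(1) downs_mono[of t "max t (2 * n)" lam] downs_ge_length[of lam "max t (2 * n)"]
      downs_ge_length[of lam "2 * n"] by (simp add: dyck_path_iff)
  moreover have "downs \<mu> (length \<mu>) = n" using assms(2) by (simp add: dyck_path_iff)
  ultimately show ?thesis
    by (force simp: region_def cell_above_iff cell_below_iff intro: less_le_trans)
qed

lemma finite_region:
  assumes "dyck_path n lam" "dyck_path n \<mu>"
  shows "finite (region lam \<mu>)"
proof (rule finite_subset)
  show "region lam \<mu> \<subseteq> {0..int n} \<times> {- int n..2 * int n}"
  proof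
    fix c assume c: "c \<in> region lam \<mu>"
    obtain a b where ab: "c = (a, b)" by (cases c)
    have mem: "int (downs \<mu> (nat (a + b + 1))) \<le> a" "a < int (downs lam (nat (a + b + 1)))"
      using c mem_region_iff[OF assms] ab by auto
    have below: "a < int n"
      using c assms(2) by (auto simp: ab region_def cell_below_iff dyck_path_iff)
    have "nat (a + b + 1) < 2 * n"
    proof (rule ccontr)
      assume "\<not> nat (a + b + 1) < 2 * n"
      then have "downs \<mu> (2 * n) \<le> downs \<mu> (nat (a + b + 1))" by (intro downs_mono) simp
      then show False using assms(2) mem below by (simp add: dyck_path_iff)
    qed
    moreover have "nat (a + b + 1) > 0"
      using mem by (cases "nat (a + b + 1)") auto
    ultimately show "c \<in> {0..int n} \<times> {- int n..2 * int n}"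
      using mem below by (auto simp: ab)
  qed
qed simp

text \<open>
  The point is that a cell of the region, moved by \<open>(1, -1)\<close>, either stays in the region or ends up
  below the lower path. It cannot leave the grid on the right, since in the last column no cell
  of the grid is above a Dyck path.
\<close>

lemma dyck_tiling_iff:
  "dyck_tiling n lam \<mu> D \<longleftrightarrow>
    dyck_path n lam \<and> dyck_path n \<mu> \<and> (\<forall>k. downs \<mu> k \<le> downs lam k) \<and>
    partition_on (region lam \<mu>) D \<and> (\<forall>\<eta>\<in>D. dyck_tile \<eta>) \<and> cover_inclusive_in (region lam \<mu>) D"
proof (cases "dyck_path n lam \<and> dyck_path n \<mu>")
  case True
  then have dyck: "dyck_path n lam" "dyck_path n \<mu>" by auto
  have len: "length lam = 2 * n" "length \<mu> = 2 * n" and tot: "downs lam (2 * n) = n" "downs \<mu> (2 * n) = n"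
    using dyck by (auto simp: dyck_path_iff)
  have above: "weakly_above n \<mu> lam \<longleftrightarrow> (\<forall>k. downs \<mu> k \<le> downs lam k)"
  proof -
    have "downs \<mu> k = downs lam k" if "\<not> k \<le> 2 * n" for k
      using that len tot downs_ge_length[of lam k] downs_ge_length[of \<mu> k]
        downs_ge_length[of lam "2 * n"] downs_ge_length[of \<mu> "2 * n"] by simp
    then have "(\<forall>k. downs \<mu> k \<le> downs lam k) \<longleftrightarrow> (\<forall>k\<le>2 * n. downs \<mu> k \<le> downs lam k)"
      by (metis order_refl)
    then show ?thesis by (simp add: weakly_above_def vertex_eq len)
  qed
  have "cell_below lam (slide c) \<longleftrightarrow> slide c \<notin> region lam \<mu>" if c: "c \<in> region lam \<mu>" for c
  proof -
    obtain a b where ab: "c = (a, b)" by (cases c)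
    let ?t = "nat (a + b + 1)"
    have mem: "int (downs \<mu> ?t) \<le> a" "a < int (downs lam ?t)"
      using c mem_region_iff[OF dyck] ab by auto
    have "a + 1 < int n" if "int (downs lam ?t) \<le> a + 1"
    proof (rule ccontr)
      assume "\<not> a + 1 < int n"
      moreover have "a < int n"
        using c dyck(2) by (auto simp: ab region_def cell_below_iff dyck_path_iff)
      ultimately have a: "a = int n - 1" "downs lam ?t = n" using mem that by auto
      have "?t < 2 * n"
      proof (rule ccontr)
        assume "\<not> ?t < 2 * n"
        then have "downs \<mu> (2 * n) \<le> downs \<mu> ?t" by (intro downs_mono) simp
        then show False using mem a tot by simp
      qed
      then have "2 * downs lam ?t \<le> ?t" using dyck(1) by (simp add: dyck_path_iff)
      then show False using \<open>?t < 2 * n\<close> a by simp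
    qed
    then show ?thesis
      using mem tot by (auto simp: ab slide_def cell_below_iff mem_region_iff[OF dyck] len)
  qed
  then have "cover_inclusive lam D \<longleftrightarrow> cover_inclusive_in (region lam \<mu>) D"
    if "partition_on (region lam \<mu>) D"
    using partition_onD1[OF that] unfolding cover_inclusive_def cover_inclusive_in_def translate_slide
    by (intro ball_cong refl arg_cong2[of _ _ _ _ "(\<or>)"] arg_cong2[of _ _ _ _ "(\<and>)"] bex_cong) blast+
  with above True show ?thesis by (auto simp: dyck_tiling_def)
qed (auto simp: dyck_tiling_def)

lemma dyck_tile_singleton: "dyck_tile {c}"
proof -
  have "dyck_path 0 []" by (simp add: dyck_path_iff)
  moreover have "{c} = translate c (vertices [])"
    by (simp add: translate_def vertices_def vertex_def)
  ultimately show ?thesis unfolding dyck_tile_def by blast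
qed

lemma finite_tiling: "dyck_tiling n lam \<mu> D \<Longrightarrow> finite D"
  unfolding dyck_tiling_def by (blast intro: finite_elements finite_region)

definition dyck_tilings_sum :: "nat \<Rightarrow> step list \<Rightarrow> int poly" where
  "dyck_tilings_sum n \<mu> = (\<Sum>D\<in>dyck_tilings_upper n \<mu>. monom 1 (tiles D))"

lemma downs_flip:
  "downs (\<alpha> @ [Down, Up] @ \<beta>) k = downs (\<alpha> @ [Up, Down] @ \<beta>) k + (if k = Suc (length \<alpha>) then 1 else 0)"
proof -
  have "downs [Down, Up] j = downs [Up, Down] j + (if j = 1 then 1 else 0)" for j
    by (auto simp: downs_def take_Cons' split: nat.splits)
  then show ?thesis by (simp only: downs_append) auto
qed

lemma downs_before_flip:
  "downs (\<alpha> @ [Up, Down] @ \<beta>) (Suc (length \<alpha>)) = downs \<alpha> (length \<alpha>)"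
  by (simp add: downs_append downs_ge_length) (simp add: downs_def)

section \<open>Removing a one-cell tile under a peak\<close>

text \<open>
  Flipping a peak changes a single vertex of the upper path, hence the region on a single
  antidiagonal, where it loses its topmost cell. The lower left corner of this cell is the vertex at
  the end of \<open>\<alpha>\<close>.
\<close>

lemma region_flip:
  assumes "dyck_path n lam" "dyck_path n (\<alpha> @ [Up, Down] @ \<beta>)" "dyck_path n (\<alpha> @ [Down, Up] @ \<beta>)"
    and "downs (\<alpha> @ [Down, Up] @ \<beta>) (Suc (length \<alpha>)) \<le> downs lam (Suc (length \<alpha>))"
  shows "region lam (\<alpha> @ [Up, Down] @ \<beta>) = insert (vertex \<alpha> (length \<alpha>)) (region lam (\<alpha> @ [Down, Up] @ \<beta>))"
    and "vertex \<alpha> (length \<alpha>) \<notin> region lam (\<alpha> @ [Down, Up] @ \<beta>)"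
proof -
  define \<mu> where "\<mu> = \<alpha> @ [Up, Down] @ \<beta>"
  define \<mu>' where "\<mu>' = \<alpha> @ [Down, Up] @ \<beta>"
  define s where "s = length \<alpha>"
  define x where "x = downs \<alpha> s"
  have v: "vertex \<alpha> (length \<alpha>) = (int x, int s - int x)" by (simp add: vertex_eq x_def s_def)
  have flip: "downs \<mu>' k = downs \<mu> k + (if k = Suc s then 1 else 0)" for k
    unfolding \<mu>_def \<mu>'_def s_def by (rule downs_flip)
  have x: "downs \<mu> (Suc s) = x" unfolding \<mu>_def s_def x_def by (rule downs_before_flip)
  note mem = mem_region_iff[OF assms(1,2), folded \<mu>_def] mem_region_iff[OF assms(1,3), folded \<mu>'_def]
  have lam: "Suc x \<le> downs lam (Suc s)" using assms(4) flip x unfolding \<mu>'_def[symmetric] s_def[symmetric] by simp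
  have t: "nat (int s + 1) = Suc s" by simp
  have "(a, b) \<in> region lam \<mu> \<longleftrightarrow> (a, b) = (int x, int s - int x) \<or> (a, b) \<in> region lam \<mu>'" for a b
  proof (cases "a + b = int s")
    case True
    then have b: "b = int s - a" by linarith
    show ?thesis using lam by (auto simp: mem b t flip x)
  next
    case False
    then have "nat (a + b + 1) = Suc s \<Longrightarrow> False" by linarith
    then show ?thesis using False by (auto simp: mem flip)
  qed
  then show "region lam (\<alpha> @ [Up, Down] @ \<beta>) = insert (vertex \<alpha> (length \<alpha>)) (region lam (\<alpha> @ [Down, Up] @ \<beta>))"
    unfolding v \<mu>_def[symmetric] \<mu>'_def[symmetric] by auto
  show "vertex \<alpha> (length \<alpha>) \<notin> region lam (\<alpha> @ [Down, Up] @ \<beta>)"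
    unfolding v \<mu>'_def[symmetric] by (simp add: mem t flip x)
qed

text \<open>
  A one-cell tile at the peak never conflicts with cover-inclusivity: its translate is one cell,
  so it lies in some tile or in none, and it covers no translate, being topmost on its
  antidiagonal. If the flipped path is not a Dyck path, both sides are empty, since then the cell
  under the peak is below the diagonal and cannot belong to the region.
\<close>

lemma tilings_with_peak_tile:
  fixes \<alpha> \<beta> :: "step list"
  defines "\<mu> \<equiv> \<alpha> @ [Up, Down] @ \<beta>" and "\<mu>' \<equiv> \<alpha> @ [Down, Up] @ \<beta>" and "c \<equiv> vertex \<alpha> (length \<alpha>)"
  assumes dyck: "dyck_path n \<mu>"
  shows "{D \<in> dyck_tilings_upper n \<mu>. {c} \<in> D} = insert {c} ` dyck_tilings_upper n \<mu>'"
    and "D \<in> dyck_tilings_upper n \<mu>' \<Longrightarrow> {c} \<notin> D"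
proof -
  define s where "s = length \<alpha>"
  define x where "x = downs \<alpha> s"
  have c: "c = (int x, int s - int x)" by (simp add: vertex_eq x_def s_def c_def)
  have flip: "downs \<mu>' k = downs \<mu> k + (if k = Suc s then 1 else 0)" for k
    unfolding \<mu>_def \<mu>'_def s_def by (rule downs_flip)
  have x: "downs \<mu> (Suc s) = x" unfolding \<mu>_def s_def x_def by (rule downs_before_flip)
  have t: "nat (int s + 1) = Suc s" by simp
  note region = region_flip[of n _ \<alpha> \<beta>, folded \<mu>_def \<mu>'_def c_def s_def, OF _ dyck]
  have slide_top: "d \<notin> region lam \<mu>" if "slide d = c" "dyck_path n lam" for d lam
  proof -
    have "d = (int x - 1, int s - int x + 1)" using that(1) by (cases d) (simp add: slide_def c)
    then show ?thesis by (simp add: mem_region_iff[OF that(2) dyck] t x)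
  qed
  show fresh: "{c} \<notin> D" if D: "D \<in> dyck_tilings_upper n \<mu>'" for D
  proof -
    obtain lam where "dyck_tiling n lam \<mu>' D" using D by (auto simp: dyck_tilings_upper_def)
    then have lam: "dyck_path n lam" "dyck_path n \<mu>'" "downs \<mu>' (Suc s) \<le> downs lam (Suc s)"
      "partition_on (region lam \<mu>') D" by (auto simp: dyck_tiling_iff)
    show ?thesis using region(2)[OF lam(1-3)] partition_onD1[OF lam(4)] by auto
  qed
  show "{D \<in> dyck_tilings_upper n \<mu>. {c} \<in> D} = insert {c} ` dyck_tilings_upper n \<mu>'"
  proof (intro equalityI subsetI)
    fix D assume "D \<in> insert {c} ` dyck_tilings_upper n \<mu>'"
    then obtain D' lam where D: "D = insert {c} D'" and til: "dyck_tiling n lam \<mu>' D'"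
      by (auto simp: dyck_tilings_upper_def)
    then have lam: "dyck_path n lam" "dyck_path n \<mu>'" and le: "\<And>k. downs \<mu>' k \<le> downs lam k"
      and part: "partition_on (region lam \<mu>') D'" and dtile: "\<forall>\<eta>\<in>D'. dyck_tile \<eta>"
      and cov: "cover_inclusive_in (region lam \<mu>') D'" by (auto simp: dyck_tiling_iff)
    have R: "region lam \<mu> = insert c (region lam \<mu>')" "c \<notin> region lam \<mu>'"
      using region[OF lam le] by auto
    have "downs \<mu> k \<le> downs lam k" for k using le[of k] flip[of k] by simp
    moreover have "partition_on (region lam \<mu>) D"
      unfolding D R(1) using R(2) part partition_onD1[OF part]
      by (subst partition_on_insert) (auto simp: disjnt_def)
    moreover have "cover_inclusive_in (region lam \<mu>) D"
      unfolding cover_inclusive_in_def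
    proof
      fix \<eta> assume "\<eta> \<in> D"
      then consider "\<eta> = {c}" | "\<eta> \<in> D'" using D by blast
      then show "slide ` \<eta> \<inter> region lam \<mu> = {} \<or> (\<exists>\<eta>'\<in>D. \<eta>' \<noteq> \<eta> \<and> slide ` \<eta> \<subseteq> \<eta>')"
      proof cases
        case 1
        have "slide c \<noteq> c" by (cases c) (simp add: slide_def)
        show ?thesis
        proof (cases "slide c \<in> region lam \<mu>'")
          case True
          then obtain \<eta>' where "\<eta>' \<in> D'" "slide c \<in> \<eta>'" using partition_onD1[OF part] by blast
          then show ?thesis using 1 D \<open>slide c \<noteq> c\<close> by auto
        next
          case False
          then show ?thesis using 1 R \<open>slide c \<noteq> c\<close> by auto
        qed
      next
        case 2
        then have "c \<notin> slide ` \<eta>"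
          using slide_top[OF _ lam(1)] partition_onD1[OF part] R(1) by blast
        moreover have "slide ` \<eta> \<inter> region lam \<mu>' = {} \<or> (\<exists>\<eta>'\<in>D'. \<eta>' \<noteq> \<eta> \<and> slide ` \<eta> \<subseteq> \<eta>')"
          using 2 cov unfolding cover_inclusive_in_def by blast
        ultimately show ?thesis unfolding D R(1) by simp blast
      qed
    qed
    ultimately have "dyck_tiling n lam \<mu> D"
      using lam dyck dtile D dyck_tile_singleton by (auto simp: dyck_tiling_iff)
    then show "D \<in> {D \<in> dyck_tilings_upper n \<mu>. {c} \<in> D}" using D by (auto simp: dyck_tilings_upper_def)
  next
    fix D assume "D \<in> {D \<in> dyck_tilings_upper n \<mu>. {c} \<in> D}"
    then obtain lam where D: "{c} \<in> D" and til: "dyck_tiling n lam \<mu> D"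
      by (auto simp: dyck_tilings_upper_def)
    then have lam: "dyck_path n lam" and le: "\<And>k. downs \<mu> k \<le> downs lam k"
      and part: "partition_on (region lam \<mu>) D" and dtile: "\<forall>\<eta>\<in>D. dyck_tile \<eta>"
      and cov: "cover_inclusive_in (region lam \<mu>) D" by (auto simp: dyck_tiling_iff)
    have "c \<in> region lam \<mu>" using D partition_onD1[OF part] by blast
    then have "x < downs lam (Suc s)" by (simp add: mem_region_iff[OF lam dyck] c t)
    then have le': "downs \<mu>' k \<le> downs lam k" for k using le[of k] flip[of k] x by auto
    have tot: "length \<mu> = 2 * n" "downs \<mu> (2 * n) = n" "downs lam (2 * n) = n"
      using dyck lam by (auto simp: dyck_path_iff)
    have "length \<mu>' = 2 * n" using tot(1) by (simp add: \<mu>_def \<mu>'_def)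
    moreover have "downs \<mu>' (2 * n) = n" using le'[of "2 * n"] flip[of "2 * n"] tot by linarith
    moreover have "2 * downs \<mu>' k \<le> k" if "k \<le> 2 * n" for k
      using le'[of k] lam that by (fastforce simp: dyck_path_iff)
    ultimately have dyck': "dyck_path n \<mu>'" by (simp add: dyck_path_iff)
    have R: "region lam \<mu> = insert c (region lam \<mu>')" "c \<notin> region lam \<mu>'"
      using region[OF lam dyck' le'] by auto
    define D' where "D' = D - {{c}}"
    have DD': "D = insert {c} D'" using D by (auto simp: D'_def)
    have "disjnt {c} \<eta>" if "\<eta> \<in> D'" for \<eta>
      using pairwiseD[OF partition_onD2[OF part] D, of \<eta>] that unfolding D'_def by blast
    then have "disjnt {c} (\<Union>D')" by (auto simp: disjnt_def)
    then have part': "partition_on (region lam \<mu>') D'"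
      using part R partition_on_insert[of "{c}" D' "region lam \<mu>"] unfolding DD' by simp
    moreover have "cover_inclusive_in (region lam \<mu>') D'"
      unfolding cover_inclusive_in_def
    proof
      fix \<eta> assume \<eta>: "\<eta> \<in> D'"
      then have "\<eta> \<noteq> {}" using partition_onD3[OF part'] by auto
      moreover have "c \<notin> slide ` \<eta>"
        using \<eta> slide_top[OF _ lam] partition_onD1[OF part'] R(1) by blast
      ultimately have "\<not> slide ` \<eta> \<subseteq> {c}" by blast
      moreover have "slide ` \<eta> \<inter> region lam \<mu> = {} \<or> (\<exists>\<eta>'\<in>D. \<eta>' \<noteq> \<eta> \<and> slide ` \<eta> \<subseteq> \<eta>')"
        using cov \<eta> unfolding cover_inclusive_in_def D'_def by blast
      ultimately show "slide ` \<eta> \<inter> region lam \<mu>' = {} \<or> (\<exists>\<eta>'\<in>D'. \<eta>' \<noteq> \<eta> \<and> slide ` \<eta> \<subseteq> \<eta>')"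
        unfolding DD' R(1) by auto
    qed
    ultimately have "dyck_tiling n lam \<mu>' D'"
      using lam dyck' le' dtile D'_def by (auto simp: dyck_tiling_iff)
    then show "D \<in> insert {c} ` dyck_tilings_upper n \<mu>'" using DD' by (auto simp: dyck_tilings_upper_def)
  qed
qed

section \<open>Cutting out a pair of steps\<close>

text \<open>
  The map cuts out the strip between the antidiagonals \<open>x + y = s\<close> and \<open>x + y = s + 2\<close>: three cells
  forming a peak, with centers on the antidiagonals \<open>s\<close>, \<open>s + 1\<close> and \<open>s + 2\<close>, are collapsed to one, and
  the cells beyond are shifted back by \<open>(1, 1)\<close>. A cell whose center is not on the antidiagonal
  \<open>s\<close> has a single preimage. Thus taking preimages inserts an up and a down step into each tile that
  has a center on this antidiagonal, just as \<open>stretch s\<close> does with paths.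
\<close>

definition squeeze :: "nat \<Rightarrow> cell \<Rightarrow> cell" where
  "squeeze s = (\<lambda>(a, b). if a + b + 1 \<le> int s then (a, b)
                 else if a + b = int s then (a, b - 1) else (a - 1, b - 1))"

definition stretch :: "nat \<Rightarrow> step list \<Rightarrow> step list" where
  "stretch s p = take s p @ [Up, Down] @ drop s p"

lemma vimage_cells_eqI: "(\<And>a b. f (a, b) \<in> X \<longleftrightarrow> (a, b) \<in> Y) \<Longrightarrow> f -` X = Y"
  by (simp add: set_eq_iff)

lemma surj_squeeze: "surj (squeeze s)"
proof (rule surjI)
  fix c :: cell
  show "squeeze s (if fst c + snd c + 1 \<le> int s then c else (fst c + 1, snd c + 1)) = c"
    by (cases c) (auto simp: squeeze_def)
qed

lemma squeeze_slide: "squeeze s (slide c) = slide (squeeze s c)"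
  by (cases c) (auto simp: squeeze_def slide_def)

lemma squeeze_fiber:
  assumes "squeeze s y = squeeze s z"
  shows "y = z \<or> (\<exists>a b. a + b + 1 = int s \<and> {y, z} \<subseteq> {(a, b), (a, b + 1), (a + 1, b + 1)})"
proof -
  obtain a b where sq: "squeeze s y = (a, b)" by (cases "squeeze s y")
  have fib: "w \<in> {(a, b), (a, b + 1), (a + 1, b + 1)} \<and> (a + b + 1 < int s \<longrightarrow> w = (a, b)) \<and>
      (a + b + 1 > int s \<longrightarrow> w = (a + 1, b + 1))"
    if "squeeze s w = (a, b)" for w
    using that by (cases w) (auto simp: squeeze_def split: if_splits)
  show ?thesis using fib[of y] fib[of z] sq assms by (cases "a + b + 1" "int s" rule: linorder_cases) auto
qed

lemma squeeze_middle:
  assumes "a + b + 1 = int s"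
  shows "squeeze s (a, b) = (a, b)" "squeeze s (a, b + 1) = (a, b)" "squeeze s (a + 1, b + 1) = (a, b)"
  using assms by (auto simp: squeeze_def)

lemma length_stretch [simp]: "length (stretch s p) = length p + 2"
  by (simp add: stretch_def)

lemma downs_stretch:
  assumes "s \<le> length p"
  shows "downs (stretch s p) k =
    (if k \<le> s then downs p k else if k = Suc s then downs p s else downs p (k - 2) + 1)"
proof -
  have split: "downs p j = downs (take s p) j + downs (drop s p) (j - s)" for j
    using downs_append[of "take s p" "drop s p" j] assms by simp
  have full: "downs (take s p) j = downs (take s p) s" if "s \<le> j" for j
    using that assms by (simp add: downs_def)
  have UD: "downs [Up, Down] j = (if j \<le> 1 then 0 else 1)" for j
    by (auto simp: downs_def take_Cons' split: nat.splits)
  have st: "downs (stretch s p) k = downs (take s p) k + (downs [Up, Down] (k - s) + downs (drop s p) (k - s - 2))"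
    unfolding stretch_def by (simp only: downs_append) (use assms in simp)
  consider "k \<le> s" | "k = Suc s" | "k \<ge> s + 2" by linarith
  then show ?thesis
  proof cases
    case 3
    then have "k - s - 2 = k - 2 - s" "s \<le> k - 2" "s \<le> k" by auto
    then show ?thesis using 3 full[of k] full[of "k - 2"] split[of "k - 2"] by (simp add: st UD)
  qed (use full[of "Suc s"] split[of k] split[of s] st in \<open>simp_all add: UD\<close>)
qed

lemma stretch_take_drop:
  assumes "Suc s < length p" "p ! s = Up" "p ! Suc s = Down"
  shows "p = stretch s (take s p @ drop (s + 2) p)"
proof -
  have "p = take s p @ p ! s # p ! Suc s # drop (s + 2) p"
    using assms(1) by (metis Cons_nth_drop_Suc Suc_lessD add_2_eq_Suc' append_take_drop_id)
  then show ?thesis using assms by (simp add: stretch_def)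
qed

lemma dyck_path_stretch_iff:
  assumes "s \<le> length p"
  shows "dyck_path (Suc k) (stretch s p) \<longleftrightarrow> dyck_path k p"
proof (cases "length p = 2 * k")
  case True
  have "(\<forall>j\<le>2 * Suc k. 2 * downs (stretch s p) j \<le> j) \<longleftrightarrow> (\<forall>j\<le>2 * k. 2 * downs p j \<le> j)"
  proof (intro iffI allI impI)
    fix j assume *: "\<forall>j\<le>2 * Suc k. 2 * downs (stretch s p) j \<le> j" "j \<le> 2 * k"
    show "2 * downs p j \<le> j"
    proof (cases "j \<le> s")
      case True
      then show ?thesis using *(1)[rule_format, of j] *(2) by (simp add: downs_stretch[OF assms])
    next
      case False
      then show ?thesis using *(1)[rule_format, of "j + 2"] *(2) by (simp add: downs_stretch[OF assms])
    qed
  next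
    fix j assume *: "\<forall>j\<le>2 * k. 2 * downs p j \<le> j" "j \<le> 2 * Suc k"
    show "2 * downs (stretch s p) j \<le> j"
    proof (cases "j \<le> Suc s")
      case True
      then show ?thesis
        using *(1)[rule_format, of j] *(1)[rule_format, of s] assms \<open>length p = 2 * k\<close>
        by (auto simp: downs_stretch[OF assms])
    next
      case False
      then have "2 * downs p (j - 2) \<le> j - 2" using *(1)[rule_format, of "j - 2"] *(2) by simp
      then show ?thesis using False by (auto simp: downs_stretch[OF assms])
    qed
  qed
  moreover have "downs (stretch s p) (2 * Suc k) = Suc (downs p (2 * k))"
    using assms True by (simp add: downs_stretch[OF assms])
  ultimately show ?thesis using True unfolding dyck_path_iff by simp
qed (simp add: dyck_path_iff)

lemma region_stretch:
  assumes "dyck_path n lam" "dyck_path n \<mu>" "s \<le> 2 * n"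
  shows "region (stretch s lam) (stretch s \<mu>) = squeeze s -` region lam \<mu>"
proof -
  have s: "s \<le> length lam" "s \<le> length \<mu>" using assms by (auto simp: dyck_path_iff)
  have dyck: "dyck_path (Suc n) (stretch s lam)" "dyck_path (Suc n) (stretch s \<mu>)"
    using assms s by (auto simp: dyck_path_stretch_iff)
  have "(a, b) \<in> region (stretch s lam) (stretch s \<mu>) \<longleftrightarrow> squeeze s (a, b) \<in> region lam \<mu>" for a b
  proof -
    consider "a + b + 1 \<le> int s" | "a + b = int s" | "a + b > int s" by linarith
    then show ?thesis
    proof cases
      case 1
      then have "nat (a + b + 1) \<le> s" by linarith
      then show ?thesis
        using 1 by (simp add: squeeze_def mem_region_iff[OF dyck] mem_region_iff[OF assms(1,2)] downs_stretch s)
    next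
      case 2
      then have "nat (a + b + 1) = Suc s" "nat (a + b) = s" by auto
      then show ?thesis
        using 2 by (simp add: squeeze_def mem_region_iff[OF dyck] mem_region_iff[OF assms(1,2)] downs_stretch s)
    next
      case 3
      then have "\<not> nat (a + b + 1) \<le> s" "nat (a + b + 1) \<noteq> Suc s" "nat (a + b + 1) - 2 = nat (a + b - 1)"
        by auto
      then show ?thesis
        using 3 by (auto simp: squeeze_def mem_region_iff[OF dyck] mem_region_iff[OF assms(1,2)] downs_stretch s)
    qed
  qed
  then show ?thesis by (intro vimage_cells_eqI[symmetric]) simp
qed

lemma vertices_append:
  "vertices (p @ q) = vertices p \<union> translate (vertex p (length p)) (vertices q)"
proof -
  have "vertex (p @ q) ` {0..length p} = vertices p"
    unfolding vertices_def by (intro image_cong) (auto simp: vertex_def)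
  moreover have "vertex (p @ q) ` {length p..length p + length q} = translate (vertex p (length p)) (vertices q)"
  proof -
    have "{length p..length p + length q} = (\<lambda>k. k + length p) ` {0..length q}"
      by (simp add: image_add_atLeastAtMost add.commute)
    then have "vertex (p @ q) ` {length p..length p + length q} = (\<lambda>k. vertex (p @ q) (k + length p)) ` {0..length q}"
      by (simp only: image_image)
    also have "\<dots> = (\<lambda>k. (fst (vertex q k) + fst (vertex p (length p)), snd (vertex q k) + snd (vertex p (length p)))) ` {0..length q}"
      by (intro image_cong) (auto simp: vertex_def)
    finally show ?thesis by (simp add: translate_def vertices_def image_image case_prod_beta)
  qed
  moreover have "{0..length (p @ q)} = {0..length p} \<union> {length p..length p + length q}" by auto
  ultimately show ?thesis unfolding vertices_def[of "p @ q"] by (simp add: image_Un)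
qed

lemma mem_translate: "(a, b) \<in> translate v S \<longleftrightarrow> (a - fst v, b - snd v) \<in> S"
  by (force simp: translate_def)

lemma vertex_time: "(x, y) \<in> vertices p \<longleftrightarrow> 0 \<le> x + y \<and> x + y \<le> int (length p) \<and> (x, y) = vertex p (nat (x + y))"
proof
  assume "(x, y) \<in> vertices p"
  then obtain k where "k \<le> length p" "(x, y) = vertex p k" by (auto simp: vertices_def)
  then show "0 \<le> x + y \<and> x + y \<le> int (length p) \<and> (x, y) = vertex p (nat (x + y))"
    by (auto simp: vertex_eq)
next
  assume "0 \<le> x + y \<and> x + y \<le> int (length p) \<and> (x, y) = vertex p (nat (x + y))"
  then show "(x, y) \<in> vertices p" by (auto simp: vertices_def)
qed

text \<open>
  The assumption says that the tile is on the antidiagonal \<open>s\<close> at the end of \<open>p\<close>.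
\<close>

lemma squeeze_vimage_vertices:
  assumes "fst v + snd v + 1 + int (length p) = int s"
  shows "squeeze s -` translate v (vertices (p @ q)) = translate v (vertices (p @ [Up, Down] @ q))"
proof -
  define e where "e = vertex p (length p)"
  define e1 e2 where "e1 = fst e" and "e2 = snd e"
  have e: "e = (e1, e2)" "e1 + e2 = int (length p)" by (auto simp: e_def e1_def e2_def vertex_eq)
  have p: "0 \<le> x + y \<and> x + y \<le> int (length p) \<and> (x + y = int (length p) \<longrightarrow> x = e1 \<and> y = e2)"
    if "(x, y) \<in> vertices p" for x y
    using that e unfolding vertex_time e_def by auto
  have ep: "(e1, e2) \<in> vertices p" unfolding vertex_time using e by (auto simp: e_def)
  have q: "0 \<le> x + y \<and> (x + y = 0 \<longrightarrow> x = 0 \<and> y = 0)" if "(x, y) \<in> vertices q" for x y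
    using that unfolding vertex_time by (auto simp: vertex_def)
  have q0: "(0, 0) \<in> vertices q" by (auto simp: vertex_time vertex_def)
  have UD: "vertices [Up, Down] = {(0, 0), (0, 1), (1, 1)}" "vertex [Up, Down] 2 = (1, 1)"
    by (auto simp: vertices_def vertex_def atLeast0AtMost numeral_2_eq_2 atMost_Suc)
  have "squeeze s (a, b) \<in> translate v (vertices (p @ q)) \<longleftrightarrow>
      (a, b) \<in> translate v (vertices (p @ [Up, Down] @ q))" for a b
  proof -
    define x y where "x = a - fst v" and "y = b - snd v"
    have R: "(a, b) \<in> translate v (vertices (p @ [Up, Down] @ q)) \<longleftrightarrow>
        (x, y) \<in> vertices p \<or> (x, y) \<in> {(e1, e2), (e1, e2 + 1), (e1 + 1, e2 + 1)} \<or>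
        (x - e1 - 1, y - e2 - 1) \<in> vertices q"
      unfolding vertices_append[of p "[Up, Down] @ q"] vertices_append[of "[Up, Down]" q]
      by (auto simp: mem_translate x_def y_def UD e e_def[symmetric] numeral_2_eq_2[symmetric])
    have L: "(a - i, b - j) \<in> translate v (vertices (p @ q)) \<longleftrightarrow>
        (x - i, y - j) \<in> vertices p \<or> (x - i - e1, y - j - e2) \<in> vertices q" for i j
      unfolding vertices_append[of p q] by (simp add: mem_translate e e_def[symmetric] x_def y_def algebra_simps)
    have xy: "a + b + 1 = x + y - int (length p) + int s" using assms by (simp add: x_def y_def)
    consider "a + b + 1 \<le> int s" | "a + b = int s" | "a + b > int s" by linarith
    then show ?thesis
    proof cases
      case 1
      have sq: "squeeze s (a, b) \<in> translate v (vertices (p @ q)) \<longleftrightarrow>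
          (x, y) \<in> vertices p \<or> (x - e1, y - e2) \<in> vertices q"
        using 1 L[of 0 0] by (simp add: squeeze_def)
      have "(x - e1, y - e2) \<in> vertices q \<Longrightarrow> x = e1 \<and> y = e2"
        using q[of "x - e1" "y - e2"] 1 xy e by auto
      moreover have "(x - e1 - 1, y - e2 - 1) \<notin> vertices q"
        using q[of "x - e1 - 1" "y - e2 - 1"] 1 xy e by auto
      moreover have "(x, y) \<noteq> (e1, e2 + 1)" "(x, y) \<noteq> (e1 + 1, e2 + 1)" using 1 xy e by auto
      ultimately show ?thesis unfolding R sq using ep by blast
    next
      case 2
      have sq: "squeeze s (a, b) \<in> translate v (vertices (p @ q)) \<longleftrightarrow>
          (x, y - 1) \<in> vertices p \<or> (x - e1, y - 1 - e2) \<in> vertices q"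
        using 2 L[of 0 1] by (simp add: squeeze_def)
      have "(x, y - 1) \<in> vertices p \<longleftrightarrow> (x, y) = (e1, e2 + 1)"
        using p[of x "y - 1"] ep 2 xy e by auto
      moreover have "(x - e1, y - 1 - e2) \<in> vertices q \<longleftrightarrow> (x, y) = (e1, e2 + 1)"
        using q[of "x - e1" "y - 1 - e2"] q0 2 xy e by auto
      moreover have "(x, y) \<notin> vertices p" using p[of x y] 2 xy by auto
      moreover have "(x - e1 - 1, y - e2 - 1) \<notin> vertices q"
        using q[of "x - e1 - 1" "y - e2 - 1"] 2 xy e by auto
      moreover have "(x, y) \<noteq> (e1, e2)" "(x, y) \<noteq> (e1 + 1, e2 + 1)" using 2 xy e by auto
      ultimately show ?thesis unfolding R sq by blast
    next
      case 3
      have sq: "squeeze s (a, b) \<in> translate v (vertices (p @ q)) \<longleftrightarrow>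
          (x - 1, y - 1) \<in> vertices p \<or> (x - e1 - 1, y - e2 - 1) \<in> vertices q"
        using 3 L[of 1 1] by (simp add: squeeze_def algebra_simps)
      have "(x - 1, y - 1) \<in> vertices p \<Longrightarrow> (x, y) = (e1 + 1, e2 + 1)"
        using p[of "x - 1" "y - 1"] 3 xy e by auto
      moreover have "(x, y) \<notin> vertices p" using p[of x y] 3 xy by auto
      moreover have "(x, y) = (e1 + 1, e2 + 1) \<Longrightarrow> (x - e1 - 1, y - e2 - 1) \<in> vertices q"
        using q0 by simp
      moreover have "(x, y) \<noteq> (e1, e2)" "(x, y) \<noteq> (e1, e2 + 1)" using 3 xy e by auto
      ultimately show ?thesis unfolding R sq by blast
    qed
  qed
  then show ?thesis by (rule vimage_cells_eqI)
qed

lemma vertex_Suc: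
  assumes "k < length p"
  shows "vertex p (Suc k) =
    (case p ! k of Up \<Rightarrow> (fst (vertex p k), snd (vertex p k) + 1)
                 | Down \<Rightarrow> (fst (vertex p k) + 1, snd (vertex p k)))"
  using assms by (cases "p ! k") (simp_all add: vertex_eq downs_Suc)

text \<open>
  A tile whose centers lie entirely on one side of the antidiagonal \<open>s\<close> is at most translated; a tile with
  a center on it has a peak inserted, which preserves Dyck paths.
\<close>

lemma dyck_tile_squeeze:
  assumes "dyck_tile X"
  shows "dyck_tile (squeeze s -` X)"
proof -
  obtain k p v where p: "dyck_path k p" "X = translate v (vertices p)"
    using assms by (auto simp: dyck_tile_def)
  define t where "t = fst v + snd v + 1"
  have len: "length p = 2 * k" using p by (simp add: dyck_path_iff)
  have time: "t \<le> a + b + 1 \<and> a + b + 1 \<le> t + 2 * int k" if "(a, b) \<in> X" for a b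
    using that unfolding p(2) mem_translate vertex_time len t_def by auto
  consider "t > int s" | "t + 2 * int k < int s" | "t \<le> int s" "int s \<le> t + 2 * int k" by linarith
  then show ?thesis
  proof cases
    case 1
    have "squeeze s (a, b) \<in> X \<longleftrightarrow> (a - 1, b - 1) \<in> X" for a b
      using 1 time[of a b] time[of a "b - 1"] time[of "a - 1" "b - 1"] by (auto simp: squeeze_def)
    moreover have "(a - 1, b - 1) \<in> X \<longleftrightarrow> (a, b) \<in> translate (fst v + 1, snd v + 1) (vertices p)" for a b
      unfolding p(2) mem_translate by (simp add: algebra_simps)
    ultimately have "squeeze s -` X = translate (fst v + 1, snd v + 1) (vertices p)"
      by (intro vimage_cells_eqI) simp
    then show ?thesis using p(1) unfolding dyck_tile_def by blast
  next
    case 2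
    have "squeeze s (a, b) \<in> X \<longleftrightarrow> (a, b) \<in> X" for a b
      using 2 time[of a b] time[of a "b - 1"] time[of "a - 1" "b - 1"] by (auto simp: squeeze_def)
    then have "squeeze s -` X = X" by (rule vimage_cells_eqI)
    then show ?thesis using assms by simp
  next
    case 3
    define m where "m = nat (int s - t)"
    have m: "m \<le> length p" "fst v + snd v + 1 + int m = int s" using 3 by (auto simp: m_def len t_def)
    have "squeeze s -` X = translate v (vertices (stretch m p))"
      using squeeze_vimage_vertices[of v "take m p" s "drop m p"] m unfolding p(2) stretch_def by simp
    moreover have "dyck_path (Suc k) (stretch m p)" using p(1) m by (simp add: dyck_path_stretch_iff)
    ultimately show ?thesis unfolding dyck_tile_def by blast
  qed
qed

text \<open>
  A preimage under \<open>squeeze s\<close> that contains a cell with center on the antidiagonal \<open>s + 1\<close> contains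
  its neighbours \<open>(0, -1)\<close> and \<open>(1, 0)\<close> away as well, so its path has a peak there which can be cut
  out. Otherwise it avoids the strip and is at most translated.
\<close>

lemma dyck_tile_if_squeeze:
  assumes "dyck_tile (squeeze s -` X)"
  shows "dyck_tile X"
proof -
  obtain k p v where p: "dyck_path k p" "squeeze s -` X = translate v (vertices p)"
    using assms by (auto simp: dyck_tile_def)
  define Y where "Y = translate v (vertices p)"
  define t where "t = fst v + snd v + 1"
  have len: "length p = 2 * k" using p by (simp add: dyck_path_iff)
  have XY: "X = squeeze s ` Y" using surj_image_vimage_eq[OF surj_squeeze, of s X] p(2) by (simp add: Y_def)
  have sat: "(c \<in> Y) = (d \<in> Y)" if "squeeze s c = squeeze s d" for c d
    using that unfolding Y_def p(2)[symmetric] by simp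
  have time: "t \<le> a + b + 1 \<and> a + b + 1 \<le> t + 2 * int k" if "(a, b) \<in> Y" for a b
    using that unfolding Y_def mem_translate vertex_time len t_def by auto
  consider "t > int s + 1" | "t + 2 * int k < int s + 1" | "t \<le> int s + 1" "int s + 1 \<le> t + 2 * int k" by linarith
  then show ?thesis
  proof cases
    case 1
    have "squeeze s ` Y = (\<lambda>(a, b). (a - 1, b - 1)) ` Y"
      using 1 time by (intro image_cong) (fastforce simp: squeeze_def)+
    also have "\<dots> = translate (fst v - 1, snd v - 1) (vertices p)"
      unfolding Y_def translate_def image_image by (intro image_cong) auto
    finally show ?thesis using p(1) XY unfolding dyck_tile_def by blast
  next
    case 2
    have "squeeze s ` Y = (\<lambda>c. c) ` Y"
      using 2 time by (intro image_cong) (fastforce simp: squeeze_def)+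
    then have "X = translate v (vertices p)" using XY by (simp add: Y_def)
    then show ?thesis using p(1) unfolding dyck_tile_def by blast
  next
    case 3
    define m where "m = nat (int s + 1 - t)"
    have m: "m \<le> length p" "fst v + snd v + 1 + int m = int s + 1" using 3 by (auto simp: m_def len t_def)
    obtain x y where xy: "vertex p m = (x, y)" by (cases "vertex p m")
    have sum: "x + y = int m" using xy m by (auto simp: vertex_eq)
    have "(x, y) \<in> vertices p" using xy m(1) by (auto simp: vertices_def intro!: image_eqI[of _ _ m])
    then have mid: "(fst v + x, snd v + y) \<in> Y" by (simp add: Y_def mem_translate)
    have eq: "fst v + x + (snd v + y - 1) + 1 = int s" using m(2) sum by simp
    have "(fst v + x, snd v + y - 1) \<in> Y" "(fst v + x + 1, snd v + y) \<in> Y"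
      using squeeze_middle[OF eq] mid sat[of "(fst v + x, snd v + y)"] by auto
    then have "(x, y - 1) \<in> vertices p" "(x + 1, y) \<in> vertices p" by (auto simp: Y_def mem_translate)
    moreover have "nat (x + (y - 1)) = m - 1" "nat (x + 1 + y) = Suc m" using sum by linarith+
    ultimately have nb: "0 < m" "m < length p" "vertex p (m - 1) = (x, y - 1)" "vertex p (Suc m) = (x + 1, y)"
      unfolding vertex_time using sum by auto
    have "m - 1 < length p" using nb by simp
    then have "p ! (m - 1) = Up" using nb vertex_Suc[of "m - 1" p] xy by (cases "p ! (m - 1)") auto
    moreover have "p ! m = Down" using nb vertex_Suc[of m p] xy by (cases "p ! m") auto
    ultimately obtain r where r: "p = stretch (m - 1) r"
      using stretch_take_drop[of "m - 1" p] nb by auto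
    then have lr: "m - 1 \<le> length r" using nb by simp
    then obtain l where "k = Suc l" using len r by (cases k) auto
    then have "dyck_path l r" using p(1) r lr by (simp add: dyck_path_stretch_iff)
    moreover have "X = translate v (vertices r)"
    proof -
      have "squeeze s -` translate v (vertices r) = Y"
        using squeeze_vimage_vertices[of v "take (m - 1) r" s "drop (m - 1) r"] m nb lr r
        unfolding Y_def stretch_def by simp
      then have "squeeze s ` Y = translate v (vertices r)"
        using surj_image_vimage_eq[OF surj_squeeze] by metis
      then show ?thesis using XY by simp
    qed
    ultimately show ?thesis unfolding dyck_tile_def by blast
  qed
qed

section \<open>Tilings without a one-cell tile under a peak\<close>

lemma partition_on_vimage_iff:
  assumes "surj f"
  shows "partition_on (f -` R) ((-`) f ` D) \<longleftrightarrow> partition_on R D"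
proof -
  have inj: "f -` A = f -` B \<longleftrightarrow> A = B" for A B
    using surj_image_vimage_eq[OF assms] by metis
  have "\<Union> ((-`) f ` D) = f -` \<Union> D" by auto
  moreover have "f -` A \<inter> f -` B = {} \<longleftrightarrow> A \<inter> B = {}" for A B
    using inj[of "A \<inter> B" "{}"] by simp
  moreover have "{} \<in> (-`) f ` D \<longleftrightarrow> {} \<in> D"
    by (metis (no_types) image_iff inj vimage_empty)
  ultimately show ?thesis
    by (simp add: partition_on_def pairwise_def disjnt_def inj)
qed

lemma slide_vimage:
  assumes "\<And>c. f (slide c) = slide (f c)"
  shows "slide ` (f -` X) = f -` (slide ` X)"
proof -
  define unslide where "unslide c = (fst c - 1, snd c + 1)" for c :: cell
  have unslide: "slide (unslide c) = c" "unslide (slide c) = c" for c by (auto simp: slide_def unslide_def)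
  have mem: "c \<in> slide ` A \<longleftrightarrow> unslide c \<in> A" for c A using unslide by (metis image_iff)
  have "f (unslide c) = unslide (f c)" for c using assms[of "unslide c"] unslide by metis
  then show ?thesis by (intro set_eqI) (simp only: mem vimage_eq)
qed

lemma cover_inclusive_in_vimage_iff:
  assumes "surj f" "\<And>c. f (slide c) = slide (f c)"
  shows "cover_inclusive_in (f -` R) ((-`) f ` D) \<longleftrightarrow> cover_inclusive_in R D"
proof -
  have sub: "f -` A \<subseteq> f -` B \<longleftrightarrow> A \<subseteq> B" for A B
    using assms(1) by (metis surj_image_vimage_eq image_mono vimage_mono)
  have eq: "f -` A = f -` B \<longleftrightarrow> A = B" for A B
    using surj_image_vimage_eq[OF assms(1)] by metis
  have disj: "f -` A \<inter> f -` B = {} \<longleftrightarrow> A \<inter> B = {}" for A B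
    using eq[of "A \<inter> B" "{}"] by simp
  show ?thesis by (simp add: cover_inclusive_in_def slide_vimage[of f, OF assms(2)] sub eq disj)
qed

lemma dyck_tiling_stretch_iff:
  assumes "length lam = 2 * n" "length \<mu> = 2 * n" "s \<le> 2 * n"
  shows "dyck_tiling (Suc n) (stretch s lam) (stretch s \<mu>) ((-`) (squeeze s) ` D) \<longleftrightarrow> dyck_tiling n lam \<mu> D"
proof (cases "dyck_path n lam \<and> dyck_path n \<mu>")
  case True
  have "(\<forall>k. downs (stretch s \<mu>) k \<le> downs (stretch s lam) k) \<longleftrightarrow> (\<forall>k. downs \<mu> k \<le> downs lam k)"
  proof (intro iffI allI)
    fix k assume *: "\<forall>k. downs (stretch s \<mu>) k \<le> downs (stretch s lam) k"
    show "downs \<mu> k \<le> downs lam k"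
      using *[rule_format, of k] *[rule_format, of "k + 2"] assms by (auto simp: downs_stretch split: if_splits)
  qed (use assms in \<open>auto simp: downs_stretch\<close>)
  moreover have "dyck_tile (squeeze s -` X) \<longleftrightarrow> dyck_tile X" for X
    using dyck_tile_squeeze dyck_tile_if_squeeze by blast
  ultimately show ?thesis
    using assms True
    by (simp add: dyck_tiling_iff dyck_path_stretch_iff region_stretch[of n] surj_squeeze
        partition_on_vimage_iff cover_inclusive_in_vimage_iff squeeze_slide)
next
  case False
  then show ?thesis using assms by (auto simp: dyck_tiling_iff dyck_path_stretch_iff)
qed

text \<open>
  A Dyck path never drops below the height of its ends. A tile that has no cell to the left
  of \<open>(x, y)\<close> and none above it can therefore neither start nor end there; it has a peak at
  \<open>(x, y)\<close> if it is not that cell alone.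
\<close>

lemma non_singleton_tile_at_peak:
  assumes tile: "dyck_tile \<eta>" and c: "(x, y) \<in> \<eta>" "\<eta> \<noteq> {(x, y)}"
    and out: "(x - 1, y) \<notin> \<eta>" "(x, y + 1) \<notin> \<eta>"
  shows "(x, y - 1) \<in> \<eta> \<and> (x + 1, y) \<in> \<eta>"
proof -
  obtain k q v where q: "dyck_path k q" "\<eta> = translate v (vertices q)"
    using tile by (auto simp: dyck_tile_def)
  have len: "length q = 2 * k" and tot: "downs q (2 * k) = k" and le: "\<And>j. j \<le> 2 * k \<Longrightarrow> 2 * downs q j \<le> j"
    using q(1) by (auto simp: dyck_path_iff)
  have mem: "(fst v + fst (vertex q j), snd v + snd (vertex q j)) \<in> \<eta>" if "j \<le> 2 * k" for j
    using that len unfolding q(2) mem_translate by (auto simp: vertices_def)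
  obtain j where j: "j \<le> 2 * k" "x = fst v + fst (vertex q j)" "y = snd v + snd (vertex q j)"
    using c(1) len unfolding q(2) mem_translate vertices_def by (force simp: prod_eq_iff)
  have "j < 2 * k"
  proof (rule ccontr)
    assume "\<not> j < 2 * k"
    then have jk: "j = 2 * k" using j by simp
    show False
    proof (cases k)
      case 0
      then show False using c(2) len j unfolding q(2)
        by (simp add: vertices_def translate_def vertex_def)
    next
      case (Suc l)
      then have m: "2 * l + 1 < length q" "j = Suc (2 * l + 1)" using jk len by auto
      show False
      proof (cases "q ! (2 * l + 1)")
        case Up
        then show False using le[of "2 * l + 1"] tot m Suc jk by (simp add: downs_Suc)
      next
        case Down
        then show False using mem[of "2 * l + 1"] out(1) j m vertex_Suc[OF m(1)] len by simp
      qed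
    qed
  qed
  moreover have "0 < j"
  proof (rule ccontr)
    assume "\<not> 0 < j"
    then have j0: "j = 0" "0 < length q" using \<open>j < 2 * k\<close> len by auto
    show False
    proof (cases "q ! 0")
      case Up
      then show False using mem[of 1] out(2) j j0 vertex_Suc[OF j0(2)] len by (simp add: algebra_simps)
    next
      case Down
      then show False using le[of 1] j0 len by (simp add: downs_Suc)
    qed
  qed
  ultimately obtain i where i: "j = Suc i" "i < length q" "Suc i < length q" using len by (cases j) auto
  have "(x, y - 1) \<in> \<eta>"
    using mem[of i] out(1) j i vertex_Suc[OF i(2)] len by (cases "q ! i") (auto simp: algebra_simps)
  moreover have "(x + 1, y) \<in> \<eta>"
    using mem[of "Suc j"] out(2) j i vertex_Suc[OF i(3)] len by (cases "q ! Suc i") (auto simp: algebra_simps)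
  ultimately show ?thesis by blast
qed

text \<open>
  The cells of the region on the antidiagonal of the peak are visited from top to bottom; \<open>i\<close> counts
  them from \<open>0\<close>. The topmost tile, not being a single cell, passes through a peak because the region
  has no room for anything else. If
  a tile passes through a peak, its translate by \<open>(1, -1)\<close> meets the region in the next cell, so by
  cover-inclusivity it is contained in a tile, which inherits the peak.
\<close>

lemma tiling_saturated_at_peak:
  assumes til: "dyck_tiling (Suc n) lam (stretch s p) D" and s: "s \<le> length p"
    and no_peak_tile: "{vertex p s} \<notin> D"
    and mem: "(int (downs p s) + int i, int s - int (downs p s) - int i) \<in> region lam (stretch s p)"
  shows "\<exists>\<eta>\<in>D. {(int (downs p s) + int i, int s - int (downs p s) - int i),
      (int (downs p s) + int i, int s - int (downs p s) - int i - 1),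
      (int (downs p s) + int i + 1, int s - int (downs p s) - int i)} \<subseteq> \<eta>"
  using mem
proof (induction i)
  define x where "x = int (downs p s)"
  have lam: "dyck_path (Suc n) lam" "dyck_path (Suc n) (stretch s p)"
    and part: "partition_on (region lam (stretch s p)) D" and dtile: "\<forall>\<eta>\<in>D. dyck_tile \<eta>"
    and cov: "cover_inclusive_in (region lam (stretch s p)) D"
    using til by (auto simp: dyck_tiling_iff)
  note memR = mem_region_iff[OF lam]
  {
    case 0
    then obtain \<eta> where \<eta>: "\<eta> \<in> D" "(x, int s - x) \<in> \<eta>"
      using partition_onD1[OF part] by (auto simp: x_def)
    have "vertex p s = (x, int s - x)" using s by (simp add: vertex_eq x_def)
    then have "\<eta> \<noteq> {(x, int s - x)}" using no_peak_tile \<eta>(1) by metis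
    moreover have "(x - 1, int s - x) \<notin> region lam (stretch s p)" "(x, int s - x + 1) \<notin> region lam (stretch s p)"
      using s by (auto simp: memR downs_stretch x_def nat_add_distrib)
    then have "(x - 1, int s - x) \<notin> \<eta>" "(x, int s - x + 1) \<notin> \<eta>"
      using \<eta>(1) partition_onD1[OF part] by blast+
    ultimately have "(x, int s - x - 1) \<in> \<eta> \<and> (x + 1, int s - x) \<in> \<eta>"
      using dtile \<eta> by (intro non_singleton_tile_at_peak) auto
    then show ?case using \<eta> by (intro bexI[of _ \<eta>]) (auto simp: x_def)
  next
    case (Suc i)
    have "(x + int i, int s - x - int i) \<in> region lam (stretch s p)"
      using Suc.prems s by (simp add: memR downs_stretch x_def)
    then obtain \<eta> where \<eta>: "\<eta> \<in> D" "(x + int i, int s - x - int i) \<in> \<eta>"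
        "(x + int i, int s - x - int i - 1) \<in> \<eta>" "(x + int i + 1, int s - x - int i) \<in> \<eta>"
      using Suc.IH by (auto simp: x_def)
    have sl: "slide (x + int i, int s - x - int i) = (x + int (Suc i), int s - x - int (Suc i))"
        "slide (x + int i, int s - x - int i - 1) = (x + int (Suc i), int s - x - int (Suc i) - 1)"
        "slide (x + int i + 1, int s - x - int i) = (x + int (Suc i) + 1, int s - x - int (Suc i))"
      by (auto simp: slide_def)
    have "slide (x + int i, int s - x - int i) \<in> region lam (stretch s p)"
      using Suc.prems by (simp only: sl(1)) (simp only: x_def)
    then have "slide ` \<eta> \<inter> region lam (stretch s p) \<noteq> {}"
      using imageI[OF \<eta>(2), of slide] by blast
    then obtain \<eta>' where \<eta>': "\<eta>' \<in> D" "slide ` \<eta> \<subseteq> \<eta>'"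
      using cov \<eta>(1) unfolding cover_inclusive_in_def by blast
    have "(x + int (Suc i), int s - x - int (Suc i)) \<in> \<eta>'"
      "(x + int (Suc i), int s - x - int (Suc i) - 1) \<in> \<eta>'"
      "(x + int (Suc i) + 1, int s - x - int (Suc i)) \<in> \<eta>'"
      unfolding sl[symmetric] using \<eta>'(2) \<eta>(2-4) by blast+
    then show ?case
      by (intro bexI[OF _ \<eta>'(1)]) (simp only: x_def insert_subset empty_subsetI simp_thms)
  }
qed

text \<open>
  If the region is empty on the antidiagonal of the peak, the lower path touches the peak of the upper
  path and must share it. Otherwise the tile of the lowest cell there has its two neighbouring
  cells in the region, above the lower path, which leaves a peak as the only possibility.
\<close>

lemma lower_path_stretched:
  assumes til: "dyck_tiling (Suc n) lam (stretch s p) D" and s: "s \<le> length p" and len: "length p = 2 * n"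
    and no_peak_tile: "{vertex p s} \<notin> D"
  shows "lam = stretch s (take s lam @ drop (s + 2) lam)"
proof (rule stretch_take_drop)
  have lam: "dyck_path (Suc n) lam" "dyck_path (Suc n) (stretch s p)"
    and le: "\<And>k. downs (stretch s p) k \<le> downs lam k"
    and part: "partition_on (region lam (stretch s p)) D"
    using til by (auto simp: dyck_tiling_iff)
  have ll: "Suc s < length lam" using lam(1) s len by (simp add: dyck_path_iff)
  then show "Suc s < length lam" .
  note memR = mem_region_iff[OF lam]
  have le_s: "downs p s \<le> downs lam s" "downs p s + 1 \<le> downs lam (s + 2)"
    using le[of s] le[of "s + 2"] s by (auto simp: downs_stretch)
  have mono: "downs lam s \<le> downs lam (Suc s)" "downs lam (Suc s) \<le> downs lam (s + 2)"
    by (auto intro: downs_mono)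
  have "downs lam s = downs lam (Suc s) \<and> downs lam (Suc s) < downs lam (s + 2)"
  proof (cases "downs lam (Suc s) \<le> downs p s")
    case True
    then show ?thesis using le_s mono by linarith
  next
    case False
    \<comment> \<open>Counted from the top, starting with \<open>0\<close>, the lowest cell of the region here has number \<open>i\<close>.\<close>
    define i where "i = downs lam (Suc s) - 1 - downs p s"
    have i: "int (downs p s) + int i = int (downs lam (Suc s)) - 1" using False by (simp add: i_def)
    have t: "nat (int s + 1) = Suc s" "nat (int s) = s" "nat (int s + 2) = s + 2" "nat (2 + int s) = s + 2" by auto
    have "(int (downs p s) + int i, int s - int (downs p s) - int i) \<in> region lam (stretch s p)"
      using i s by (simp add: memR t downs_stretch)
    from tiling_saturated_at_peak[OF til s no_peak_tile this] partition_onD1[OF part]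
    have "(int (downs p s) + int i, int s - int (downs p s) - int i - 1) \<in> region lam (stretch s p)"
      "(int (downs p s) + int i + 1, int s - int (downs p s) - int i) \<in> region lam (stretch s p)"
      by blast+
    then have "int (downs p s) + int i < int (downs lam s)" "int (downs p s) + int i + 1 < int (downs lam (s + 2))"
      by (auto simp: memR t)
    then show ?thesis using i mono by linarith
  qed
  then have "downs lam (Suc s) = downs lam s" "downs lam (Suc (Suc s)) \<noteq> downs lam (Suc s)" by auto
  then show "lam ! s = Up" "lam ! Suc s = Down"
    using ll step.exhaust by (auto simp: downs_Suc split: if_splits)
qed

text \<open>
  Each fiber of \<open>squeeze s\<close> that meets the region is a single cell or three cells forming a peak, and
  the latter belong to one tile by \<open>tiling_saturated_at_peak\<close>.
\<close>

lemma tiles_saturated: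
  assumes til: "dyck_tiling (Suc n) (stretch s lam) (stretch s p) D" and dyck: "dyck_path n lam" "dyck_path n p"
    and s: "s \<le> 2 * n" and no_peak_tile: "{vertex p s} \<notin> D" and \<eta>: "\<eta> \<in> D"
  shows "squeeze s -` (squeeze s ` \<eta>) = \<eta>"
proof
  show "\<eta> \<subseteq> squeeze s -` (squeeze s ` \<eta>)" by auto
  show "squeeze s -` (squeeze s ` \<eta>) \<subseteq> \<eta>"
  proof
    fix z assume "z \<in> squeeze s -` (squeeze s ` \<eta>)"
    then obtain y where y: "y \<in> \<eta>" "squeeze s y = squeeze s z" by auto
    have part: "partition_on (region (stretch s lam) (stretch s p)) D"
      using til by (auto simp: dyck_tiling_iff)
    have len: "s \<le> length p" using dyck s by (simp add: dyck_path_iff)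
    note R = region_stretch[OF dyck s]
    show "z \<in> \<eta>"
    proof (cases "y = z")
      case False
      then obtain a b where ab: "a + b + 1 = int s" "{y, z} \<subseteq> {(a, b), (a, b + 1), (a + 1, b + 1)}"
        using squeeze_fiber[OF y(2)] by blast
      note middle = squeeze_middle[OF ab(1)]
      have "squeeze s y = (a, b)" using ab(2) middle by auto
      moreover have "y \<in> region (stretch s lam) (stretch s p)" using y(1) \<eta> partition_onD1[OF part] by blast
      ultimately have "(a, b + 1) \<in> region (stretch s lam) (stretch s p)" and base: "(a, b) \<in> region lam p"
        unfolding R using middle by auto
      define i where "i = nat (a - int (downs p s))"
      have "nat (a + b + 1) = s" using ab(1) by simp
      then have "int (downs p s) \<le> a" using base by (simp add: mem_region_iff[OF dyck])
      then have i: "a = int (downs p s) + int i" "b + 1 = int s - int (downs p s) - int i"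
        using ab(1) by (auto simp: i_def)
      have "(int (downs p s) + int i, int s - int (downs p s) - int i) \<in> region (stretch s lam) (stretch s p)"
        using \<open>(a, b + 1) \<in> region (stretch s lam) (stretch s p)\<close> i by simp
      note sat = tiling_saturated_at_peak[OF til len no_peak_tile this, unfolded i[symmetric]]
      obtain \<eta>' where \<eta>': "\<eta>' \<in> D" "{(a, b + 1), (a, b), (a + 1, b + 1)} \<subseteq> \<eta>'"
        using sat by auto
      then have "y \<in> \<eta>'" "z \<in> \<eta>'" using ab(2) by auto
      then have "\<eta>' = \<eta>" using y(1) \<eta> \<eta>'(1) partition_onD2[OF part] by (meson disjointD disjoint_iff)
      then show ?thesis using \<open>z \<in> \<eta>'\<close> by simp
    qed (use y in simp)
  qed
qed

text \<open>
  For the inclusion from right to left, note that every preimage containing the cell under the peak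
  also contains the cell below it, with which it is identified.
\<close>

lemma tilings_without_peak_tile:
  assumes "dyck_path n p" "s \<le> 2 * n"
  shows "{D \<in> dyck_tilings_upper (Suc n) (stretch s p). {vertex p s} \<notin> D}
    = (`) ((-`) (squeeze s)) ` dyck_tilings_upper n p"
proof (intro equalityI subsetI)
  have len: "length p = 2 * n" using assms(1) by (simp add: dyck_path_iff)
  fix D assume "D \<in> (`) ((-`) (squeeze s)) ` dyck_tilings_upper n p"
  then obtain D' lam where D: "D = (-`) (squeeze s) ` D'" and til: "dyck_tiling n lam p D'"
    by (auto simp: dyck_tilings_upper_def)
  have "length lam = 2 * n" using til by (auto simp: dyck_tiling_iff dyck_path_iff)
  then have "dyck_tiling (Suc n) (stretch s lam) (stretch s p) D"
    using til len assms(2) unfolding D by (simp add: dyck_tiling_stretch_iff)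
  moreover have "{vertex p s} \<notin> D"
  proof
    assume "{vertex p s} \<in> D"
    then obtain \<eta> where \<eta>: "{vertex p s} = squeeze s -` \<eta>" using D by auto
    obtain a b where ab: "vertex p s = (a, b + 1)" by (metis diff_add_cancel surj_pair)
    then have "a + b + 1 = int s" using len assms(2) by (auto simp: vertex_eq)
    then have "squeeze s (a, b + 1) = squeeze s (a, b)" by (simp add: squeeze_middle)
    then have "(a, b) \<in> {vertex p s}" using \<eta> ab by (metis singletonI vimage_eq)
    then show False using ab by simp
  qed
  ultimately show "D \<in> {D \<in> dyck_tilings_upper (Suc n) (stretch s p). {vertex p s} \<notin> D}"
    by (auto simp: dyck_tilings_upper_def)
next
  have len: "length p = 2 * n" using assms(1) by (simp add: dyck_path_iff)
  fix D assume "D \<in> {D \<in> dyck_tilings_upper (Suc n) (stretch s p). {vertex p s} \<notin> D}"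
  then obtain lam' where til: "dyck_tiling (Suc n) lam' (stretch s p) D" and no: "{vertex p s} \<notin> D"
    by (auto simp: dyck_tilings_upper_def)
  define lam where "lam = take s lam' @ drop (s + 2) lam'"
  have lam': "lam' = stretch s lam"
    unfolding lam_def using lower_path_stretched[OF til _ len no] len assms(2) by simp
  have dyck': "dyck_path (Suc n) lam'" using til by (auto simp: dyck_tiling_iff)
  then have ll: "length lam = 2 * n" using lam' by (simp add: dyck_path_iff)
  then have dyck: "dyck_path n lam"
    using dyck' assms(2) unfolding lam' by (simp add: dyck_path_stretch_iff)
  define D' where "D' = (`) (squeeze s) ` D"
  have "(-`) (squeeze s) ` D' = (\<lambda>\<eta>. \<eta>) ` D"
    unfolding D'_def image_image
    using tiles_saturated[OF til[unfolded lam'] dyck assms no] by (intro image_cong) auto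
  then have D: "D = (-`) (squeeze s) ` D'" by simp
  then have "dyck_tiling n lam p D'"
    using til ll len assms(2) dyck_tiling_stretch_iff[of lam n p s D'] unfolding lam' by simp
  then show "D \<in> (`) ((-`) (squeeze s)) ` dyck_tilings_upper n p"
    using D by (auto simp: dyck_tilings_upper_def)
qed

section \<open>The generating function of Dyck tilings with fixed upper path\<close>

lemma dyck_tilings_sum_peak:
  assumes dyck: "dyck_path (Suc n) (\<alpha> @ [Up, Down] @ \<beta>)"
    and fin: "finite (dyck_tilings_upper (Suc n) (\<alpha> @ [Down, Up] @ \<beta>))"
      "finite (dyck_tilings_upper n (\<alpha> @ \<beta>))"
  shows "finite (dyck_tilings_upper (Suc n) (\<alpha> @ [Up, Down] @ \<beta>))"
    and "dyck_tilings_sum (Suc n) (\<alpha> @ [Up, Down] @ \<beta>) =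
      monom 1 1 * dyck_tilings_sum (Suc n) (\<alpha> @ [Down, Up] @ \<beta>) + dyck_tilings_sum n (\<alpha> @ \<beta>)"
proof -
  define c where "c = vertex \<alpha> (length \<alpha>)"
  define s where "s = length \<alpha>"
  define \<mu> where "\<mu> = \<alpha> @ [Up, Down] @ \<beta>"
  define \<mu>' where "\<mu>' = \<alpha> @ [Down, Up] @ \<beta>"
  have st: "\<mu> = stretch s (\<alpha> @ \<beta>)" by (simp add: \<mu>_def stretch_def s_def)
  have dyck0: "dyck_path n (\<alpha> @ \<beta>)"
    using dyck unfolding \<mu>_def[symmetric] st by (subst (asm) dyck_path_stretch_iff) (simp_all add: s_def)
  then have s: "s \<le> 2 * n" by (auto simp: dyck_path_iff s_def)
  have c: "vertex (\<alpha> @ \<beta>) s = c" by (simp add: c_def s_def vertex_def)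
  let ?A = "{D \<in> dyck_tilings_upper (Suc n) \<mu>. {c} \<in> D}"
  let ?B = "{D \<in> dyck_tilings_upper (Suc n) \<mu>. {c} \<notin> D}"
  have A: "?A = insert {c} ` dyck_tilings_upper (Suc n) \<mu>'"
    unfolding c_def \<mu>_def \<mu>'_def by (rule tilings_with_peak_tile(1)[OF dyck])
  have B: "?B = (`) ((-`) (squeeze s)) ` dyck_tilings_upper n (\<alpha> @ \<beta>)"
    using tilings_without_peak_tile[OF dyck0 s] unfolding st c .
  have AB: "dyck_tilings_upper (Suc n) \<mu> = ?A \<union> ?B" by blast
  have finAB: "finite ?A" "finite ?B" unfolding A B using fin \<mu>'_def by auto
  then show "finite (dyck_tilings_upper (Suc n) (\<alpha> @ [Up, Down] @ \<beta>))"
    unfolding \<mu>_def[symmetric] by (subst AB) (rule finite_UnI)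
  have notin: "{c} \<notin> D" if "D \<in> dyck_tilings_upper (Suc n) \<mu>'" for D
    using tilings_with_peak_tile(2)[OF dyck] that unfolding c_def \<mu>'_def .
  have "inj_on (insert {c}) (dyck_tilings_upper (Suc n) \<mu>')"
    by (rule inj_onI) (use notin in \<open>metis insert_ident\<close>)
  then have "(\<Sum>D\<in>?A. monom (1::int) (tiles D)) =
      (\<Sum>D\<in>dyck_tilings_upper (Suc n) \<mu>'. monom 1 (tiles (insert {c} D)))"
    unfolding A by (simp add: sum.reindex)
  also have "\<dots> = (\<Sum>D\<in>dyck_tilings_upper (Suc n) \<mu>'. monom 1 1 * monom 1 (tiles D))"
  proof (rule sum.cong)
    fix D assume D: "D \<in> dyck_tilings_upper (Suc n) \<mu>'"
    then have "finite D" by (auto simp: dyck_tilings_upper_def intro: finite_tiling)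
    then show "monom (1::int) (tiles (insert {c} D)) = monom 1 1 * monom 1 (tiles D)"
      using notin[OF D] by (simp add: tiles_def mult_monom)
  qed simp
  finally have sumA: "(\<Sum>D\<in>?A. monom (1::int) (tiles D)) = monom 1 1 * dyck_tilings_sum (Suc n) \<mu>'"
    by (simp add: dyck_tilings_sum_def sum_distrib_left)
  have inj: "inj ((-`) (squeeze s))"
    by (rule injI) (metis surj_image_vimage_eq[OF surj_squeeze])
  then have "inj_on ((`) ((-`) (squeeze s))) (dyck_tilings_upper n (\<alpha> @ \<beta>))"
    by (intro inj_onI) (simp add: inj_image_eq_iff)
  moreover have "tiles ((-`) (squeeze s) ` D) = tiles D" for D
    unfolding tiles_def using inj by (intro card_image) (blast intro: inj_on_subset)
  ultimately have sumB: "(\<Sum>D\<in>?B. monom (1::int) (tiles D)) = dyck_tilings_sum n (\<alpha> @ \<beta>)"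
    unfolding B by (simp add: sum.reindex dyck_tilings_sum_def)
  have "dyck_tilings_sum (Suc n) \<mu> = (\<Sum>D\<in>?A \<union> ?B. monom 1 (tiles D))"
    unfolding dyck_tilings_sum_def by (subst AB) (rule refl)
  also have "\<dots> = (\<Sum>D\<in>?A. monom 1 (tiles D)) + (\<Sum>D\<in>?B. monom 1 (tiles D))"
    by (rule sum.union_disjoint) (use finAB in auto)
  finally show "dyck_tilings_sum (Suc n) (\<alpha> @ [Up, Down] @ \<beta>) =
      monom 1 1 * dyck_tilings_sum (Suc n) (\<alpha> @ [Down, Up] @ \<beta>) + dyck_tilings_sum n (\<alpha> @ \<beta>)"
    unfolding sumA sumB unfolding \<mu>_def \<mu>'_def .
qed

lemma dyck_path_0: "dyck_path 0 p \<longleftrightarrow> p = []"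
  by (auto simp: dyck_path_iff)

lemma dyck_tilings_upper_0: "dyck_tilings_upper 0 [] = {{}}"
proof -
  have nil: "dyck_path 0 []" by (simp add: dyck_path_0)
  have "region [] [] = {}" using mem_region_iff[OF nil nil] by (auto simp: downs_def)
  then have "dyck_tiling 0 lam [] D \<longleftrightarrow> lam = [] \<and> D = {}" for lam D
    by (auto simp: dyck_tiling_iff dyck_path_0 partition_on_empty cover_inclusive_in_def)
  then show ?thesis by (auto simp: dyck_tilings_upper_def)
qed

lemma split_first_Down:
  assumes "Down \<in> set p"
  shows "\<exists>m \<beta>. p = replicate m Up @ Down # \<beta>"
  using assms
proof (induction p)
  case (Cons x p)
  show ?case
  proof (cases x)
    case Up
    then obtain m \<beta> where "p = replicate m Up @ Down # \<beta>" using Cons by auto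
    then have "x # p = replicate (Suc m) Up @ Down # \<beta>" using Up by simp
    then show ?thesis by blast
  next
    case Down
    then have "x # p = replicate 0 Up @ Down # p" by simp
    then show ?thesis by blast
  qed
qed simp

lemma dyck_path_first_peak:
  assumes "dyck_path (Suc n) p"
  obtains h \<beta> where "p = replicate h Up @ [Up, Down] @ \<beta>"
proof -
  have "count_list p Down = Suc n"
    using assms downs_ge_length[of p "2 * Suc n"] by (simp add: dyck_path_iff)
  then have "Down \<in> set p" by (metis count_notin nat.distinct(1))
  then obtain m \<beta> where p: "p = replicate m Up @ Down # \<beta>" using split_first_Down by blast
  have "m \<noteq> 0"
  proof
    assume "m = 0"
    then have "downs p 1 = 1" using p by (simp add: downs_def)
    then show False using assms by (auto simp: dyck_path_iff)
  qed
  then obtain h where "m = Suc h" by (cases m) auto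
  then have "p = replicate h Up @ [Up, Down] @ \<beta>" using p by (simp add: replicate_app_Cons_same)
  then show thesis by (rule that)
qed

text \<open>
  Induction on \<open>n\<close>, and for given \<open>n\<close> on the height of the first peak: flipping the first peak lowers
  its height by one, cutting it out lowers \<open>n\<close>. A first peak of height one cannot be flipped, which
  matches the value \<open>[0]\<^sub>q = 0\<close>.
\<close>

theorem dyck_tilings_sum_eq_height_weight:
  assumes "dyck_path n \<mu>"
  shows "finite (dyck_tilings_upper n \<mu>) \<and> dyck_tilings_sum n \<mu> = height_weight 0 \<mu>"
  using assms
proof (induction n arbitrary: \<mu>)
  case 0
  then have "\<mu> = []" by (simp add: dyck_path_0)
  then show ?case by (simp add: dyck_tilings_upper_0 dyck_tilings_sum_def tiles_def monom_0)
next
  case (Suc n)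
  have "finite (dyck_tilings_upper (Suc n) \<mu>) \<and> dyck_tilings_sum (Suc n) \<mu> = height_weight 0 \<mu>"
    if "\<mu> = replicate h Up @ [Up, Down] @ \<beta>" "dyck_path (Suc n) \<mu>" for h \<beta> \<mu>
    using that
  proof (induction h arbitrary: \<mu> \<beta>)
    case 0
    have "\<not> dyck_path (Suc n) ([] @ [Down, Up] @ \<beta>)"
    proof
      assume "dyck_path (Suc n) ([] @ [Down, Up] @ \<beta>)"
      then have "\<forall>k\<le>2 * Suc n. 2 * downs ([] @ [Down, Up] @ \<beta>) k \<le> k"
        unfolding dyck_path_iff by blast
      from this[rule_format, of 1] show False by (simp add: downs_def)
    qed
    then have empty: "dyck_tilings_upper (Suc n) ([] @ [Down, Up] @ \<beta>) = {}"
      by (auto simp: dyck_tilings_upper_def dyck_tiling_iff)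
    have \<mu>: "\<mu> = [] @ [Up, Down] @ \<beta>" using 0 by simp
    have dyck: "dyck_path (Suc n) ([] @ [Up, Down] @ \<beta>)" using 0 by simp
    have "stretch 0 \<beta> = \<mu>" using \<mu> by (simp add: stretch_def)
    then have "dyck_path n ([] @ \<beta>)" using dyck_path_stretch_iff[of 0 \<beta> n] 0 by simp
    then have IH: "finite (dyck_tilings_upper n ([] @ \<beta>))" "dyck_tilings_sum n ([] @ \<beta>) = height_weight 0 ([] @ \<beta>)"
      using Suc.IH by auto
    have "q_int (Suc 0) = 1" by (simp add: q_int_Suc)
    then show ?case
      using dyck_tilings_sum_peak[OF dyck _ IH(1)] IH(2) empty unfolding \<mu>
      by (simp add: dyck_tilings_sum_def)
  next
    case (Suc h)
    define \<alpha> where "\<alpha> = replicate (Suc h) Up"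
    have \<mu>: "\<mu> = \<alpha> @ [Up, Down] @ \<beta>" using Suc.prems by (simp add: \<alpha>_def)
    then have dyck: "dyck_path (Suc n) (\<alpha> @ [Up, Down] @ \<beta>)" using Suc.prems by simp
    define \<mu>' where "\<mu>' = \<alpha> @ [Down, Up] @ \<beta>"
    have \<mu>': "\<mu>' = replicate h Up @ [Up, Down] @ (Up # \<beta>)"
      by (simp add: \<mu>'_def \<alpha>_def replicate_app_Cons_same)
    have flip: "downs \<mu>' k = downs \<mu> k + (if k = Suc (length \<alpha>) then 1 else 0)" for k
      unfolding \<mu> \<mu>'_def by (rule downs_flip)
    have "count_list (replicate m Up) Down = 0" for m by (induction m) auto
    then have "downs \<mu> (Suc (length \<alpha>)) = 0"
      unfolding \<mu> downs_before_flip by (simp add: downs_def \<alpha>_def)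
    then have "2 * downs \<mu>' k \<le> k" if "k \<le> 2 * Suc n" for k
      using that flip[of k] dyck unfolding \<mu>[symmetric] by (auto simp: dyck_path_iff \<alpha>_def)
    moreover have "downs \<mu>' (2 * Suc n) = Suc n"
    proof -
      have l: "length \<mu>' = 2 * Suc n" using dyck by (simp add: dyck_path_iff \<mu>'_def)
      then have "2 * Suc n \<noteq> Suc (length \<alpha>)" by (auto simp: \<mu>'_def)
      then show ?thesis using flip[of "2 * Suc n"] dyck unfolding \<mu>[symmetric] by (simp add: dyck_path_iff)
    qed
    moreover have "length \<mu>' = 2 * Suc n" using dyck by (simp add: dyck_path_iff \<mu>'_def)
    ultimately have "dyck_path (Suc n) \<mu>'" by (simp add: dyck_path_iff)
    from Suc.IH[OF \<mu>' this]
    have IH': "finite (dyck_tilings_upper (Suc n) \<mu>')" "dyck_tilings_sum (Suc n) \<mu>' = height_weight 0 \<mu>'" by auto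
    have "stretch (length \<alpha>) (\<alpha> @ \<beta>) = \<mu>" by (simp add: stretch_def \<mu>)
    then have "dyck_path n (\<alpha> @ \<beta>)"
      using dyck_path_stretch_iff[of "length \<alpha>" "\<alpha> @ \<beta>" n] Suc.prems(2) by simp
    then have IH: "finite (dyck_tilings_upper n (\<alpha> @ \<beta>))" "dyck_tilings_sum n (\<alpha> @ \<beta>) = height_weight 0 (\<alpha> @ \<beta>)"
      using \<open>\<And>\<mu>. dyck_path n \<mu> \<Longrightarrow> _\<close> by auto
    have w: "height_weight 0 \<mu> = q_int (Suc (Suc h)) * height_weight (Suc h) \<beta>"
      "height_weight 0 \<mu>' = q_int (Suc h) * height_weight (Suc h) \<beta>"
      "height_weight 0 (\<alpha> @ \<beta>) = height_weight (Suc h) \<beta>"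
      unfolding \<mu> \<mu>'_def \<alpha>_def height_weight_replicate_Up by simp_all
    show ?case
      using dyck_tilings_sum_peak[OF dyck IH'(1)[unfolded \<mu>'_def] IH(1)]
      unfolding \<mu>[symmetric] \<mu>'_def[symmetric] IH'(2) IH(2) w q_int_Suc[of "Suc h"]
      by (simp add: algebra_simps)
  qed
  then show ?case using dyck_path_first_peak[OF Suc.prems] Suc.prems by metis
qed

theorem theorem2p3:
  fixes n :: nat and \<sigma> :: "nat \<Rightarrow> nat" and \<mu> :: "step list"
  assumes "n \<ge> 1"
    and "\<sigma> permutes {1..n}"
    and "avoids_132 n \<sigma>"
    and "\<mu> = alpha n \<sigma>"
  shows "(\<Sum>D \<in> dyck_tilings_upper n \<mu>. monom (1::int) (tiles D)) =
    (\<Sum>\<pi> | \<pi> permutes {1..n} \<and> bruhat_le n \<sigma> \<pi>. monom 1 (inversions n \<pi> - inversions n \<sigma>))"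
  using dyck_tilings_sum_eq_height_weight[OF alpha_eq_stair(2)[OF assms(2,3)]]
  unfolding assms(4) alpha_eq_stair(1)[OF assms(2,3)] sum_bruhat_ge[OF assms(2,3)]
  by (simp only: alpha_eq_stair(3)[OF assms(2,3)] dyck_tilings_sum_def)

end
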